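(* Every transitive subsystem of a substitutive system is substitutive. Every transitive subsystem of a $k$-automatic system is $k$-automatic. (Here "$Y$ is substitutive" means $Y$ is the orbit closure of some substitutive sequence, and similarly for $k$-automatic.)
   Context: An alphabet is a finite nonempty set $\mathcal{A}$; $\mathcal{A}^*$ denotes finite words over $\mathcal{A}$ (including the empty word $\epsilon$), and $\mathcal{A}^{\omega}$ the set of sequences $(x_n)_{n\ge 0}$ over $\mathcal{A}$, with the product of discrete topologies and the shift $T((x_n)_n)=(x_{n+1})_n$. A subsystem of $\mathcal{A}^\omega$ is a closed subset $X$ with $T(X)\subseteq X$; it is transitive if it equals the orbit closure $\overline{\{T^n x : n\ge 0\}}$ of one of its points. A substitution is a map $\varphi\colon\mathcal{A}\to\mathcal{A}^*$, extended to words and sequences by concatenation; throughout, every substitution is assumed to be growing, i.e. $|\varphi^n(a)|\to\infty$ as $n\to\infty$ for every $a\in\mathcal{A}$. It has constant length $k$ if $|\varphi(a)|=k$ for all $a$. A coding is an arbitrary map between alphabets, applied letterwise. A sequence $x$ is purely substitutive if $\varphi(x)=x$ for some substitution $\varphi$, and substitutive if it is the image under a coding of a purely substitutive sequence. A sequence is purely $k$-automatic ($k\ge 2$) if it is a fixed point of a substitution of constant length $k$, and $k$-automatic if it is the image under a coding of a purely $k$-automatic sequence. A substitutive (resp. $k$-automatic) system is the orbit closure in $\mathcal{A}^\omega$ of a substitutive (resp. $k$-automatic) sequence. *)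

theory Defs
  imports "HOL-Analysis.Analysis"
begin

definition alphabet :: "'a set \<Rightarrow> bool" where
  "alphabet A \<longleftrightarrow> finite A \<and> A \<noteq> {}"

definition seq_topology :: "'a set \<Rightarrow> (nat \<Rightarrow> 'a) topology" where
  "seq_topology A = product_topology (\<lambda>_. discrete_topology A) UNIV"

definition shift :: "(nat \<Rightarrow> 'a) \<Rightarrow> nat \<Rightarrow> 'a" where
  "shift x = (\<lambda>n. x (Suc n))"

definition orbit_closure :: "'a set \<Rightarrow> (nat \<Rightarrow> 'a) \<Rightarrow> (nat \<Rightarrow> 'a) set" where
  "orbit_closure A x = seq_topology A closure_of (range (\<lambda>n. (shift ^^ n) x))"

definition subsystem :: "'a set \<Rightarrow> (nat \<Rightarrow> 'a) set \<Rightarrow> bool" where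
  "subsystem A X \<longleftrightarrow> closedin (seq_topology A) X \<and> shift ` X \<subseteq> X"

definition transitive_system :: "'a set \<Rightarrow> (nat \<Rightarrow> 'a) set \<Rightarrow> bool" where
  "transitive_system A X \<longleftrightarrow> subsystem A X \<and> (\<exists>x\<in>X. X = orbit_closure A x)"

definition subst_word :: "('a \<Rightarrow> 'b list) \<Rightarrow> 'a list \<Rightarrow> 'b list" where
  "subst_word \<phi> w = concat (map \<phi> w)"

text \<open>The letter at position \<open>n\<close> of \<open>\<phi>(x\<^sub>0)\<phi>(x\<^sub>1)\<phi>(x\<^sub>2)\<dots>\<close> is read off the image of the shortest
  prefix of \<open>x\<close> whose image is long enough. If there is no such prefix (impossible for growing
  \<open>\<phi>\<close>, where no letter has empty image), the value is unspecified.\<close>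

definition subst_seq :: "('a \<Rightarrow> 'b list) \<Rightarrow> (nat \<Rightarrow> 'a) \<Rightarrow> nat \<Rightarrow> 'b" where
  "subst_seq \<phi> x n =
     subst_word \<phi> (map x [0..<(LEAST m. n < length (subst_word \<phi> (map x [0..<m])))]) ! n"

text \<open>Substitutions are growing by convention.\<close>

definition substitution :: "'a set \<Rightarrow> ('a \<Rightarrow> 'a list) \<Rightarrow> bool" where
  "substitution A \<phi> \<longleftrightarrow> (\<forall>a\<in>A. \<phi> a \<in> lists A) \<and>
     (\<forall>a\<in>A. filterlim (\<lambda>n. length ((subst_word \<phi> ^^ n) [a])) at_top sequentially)"

definition constant_length :: "nat \<Rightarrow> 'a set \<Rightarrow> ('a \<Rightarrow> 'a list) \<Rightarrow> bool" where
  "constant_length k A \<phi> \<longleftrightarrow> (\<forall>a\<in>A. length (\<phi> a) = k)"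

definition purely_substitutive :: "'a set \<Rightarrow> (nat \<Rightarrow> 'a) \<Rightarrow> bool" where
  "purely_substitutive A x \<longleftrightarrow> alphabet A \<and> x \<in> UNIV \<rightarrow> A \<and>
     (\<exists>\<phi>. substitution A \<phi> \<and> subst_seq \<phi> x = x)"

definition purely_automatic :: "nat \<Rightarrow> 'a set \<Rightarrow> (nat \<Rightarrow> 'a) \<Rightarrow> bool" where
  "purely_automatic k A x \<longleftrightarrow> 2 \<le> k \<and> alphabet A \<and> x \<in> UNIV \<rightarrow> A \<and>
     (\<exists>\<phi>. substitution A \<phi> \<and> constant_length k A \<phi> \<and> subst_seq \<phi> x = x)"

text \<open>The alphabet coded from may be any finite nonempty set. As HOL cannot quantify over types, it
  is taken to be a set of natural numbers; \<open>substitutiveI\<close> and \<open>automaticI\<close> below show that alphabets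
  in other types give nothing new.\<close>

definition substitutive :: "'a set \<Rightarrow> (nat \<Rightarrow> 'a) \<Rightarrow> bool" where
  "substitutive A x \<longleftrightarrow>
     (\<exists>(B :: nat set) y \<pi>. purely_substitutive B y \<and> \<pi> \<in> B \<rightarrow> A \<and> x = \<pi> \<circ> y)"

definition automatic :: "nat \<Rightarrow> 'a set \<Rightarrow> (nat \<Rightarrow> 'a) \<Rightarrow> bool" where
  "automatic k A x \<longleftrightarrow>
     (\<exists>(B :: nat set) y \<pi>. purely_automatic k B y \<and> \<pi> \<in> B \<rightarrow> A \<and> x = \<pi> \<circ> y)"

definition substitutive_system :: "'a set \<Rightarrow> (nat \<Rightarrow> 'a) set \<Rightarrow> bool" where
  "substitutive_system A X \<longleftrightarrow> (\<exists>x. substitutive A x \<and> X = orbit_closure A x)"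

definition automatic_system :: "nat \<Rightarrow> 'a set \<Rightarrow> (nat \<Rightarrow> 'a) set \<Rightarrow> bool" where
  "automatic_system k A X \<longleftrightarrow> (\<exists>x. automatic k A x \<and> X = orbit_closure A x)"

lemma rename_alphabet:
  fixes f :: "'b \<Rightarrow> 'c"
  assumes inj: "inj_on f B" and y: "y \<in> UNIV \<rightarrow> B"
    and \<phi>: "substitution B \<phi>" "subst_seq \<phi> y = y"
  defines "\<psi> \<equiv> \<lambda>c. map f (\<phi> (inv_into B f c))"
  shows "substitution (f ` B) \<psi>" "subst_seq \<psi> (f \<circ> y) = f \<circ> y"
proof -
  have \<psi>f: "\<psi> (f b) = map f (\<phi> b)" if "b \<in> B" for b
    using that inj by (simp add: \<psi>_def)
  have cl: "\<phi> b \<in> lists B" if "b \<in> B" for b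
    using \<phi>(1) that by (auto simp: substitution_def)
  have word: "subst_word \<psi> (map f w) = map f (subst_word \<phi> w)" if "w \<in> lists B" for w
    using that by (induction w) (auto simp: subst_word_def \<psi>f)
  have word_cl: "subst_word \<phi> w \<in> lists B" if "w \<in> lists B" for w
    using that cl by (induction w) (auto simp: subst_word_def)
  have pow: "(subst_word \<phi> ^^ n) w \<in> lists B \<and>
      (subst_word \<psi> ^^ n) (map f w) = map f ((subst_word \<phi> ^^ n) w)" if "w \<in> lists B" for w n
    using that by (induction n) (auto simp: word word_cl simp del: in_lists_conv_set)
  have len: "length ((subst_word \<psi> ^^ n) [f b]) = length ((subst_word \<phi> ^^ n) [b])"
    if "b \<in> B" for b n
    using pow[of "[b]" n] that by simp
  show "substitution (f ` B) \<psi>"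
    using \<phi>(1) cl by (fastforce simp: substitution_def len \<psi>f)
  have grow: "filterlim (\<lambda>n. length ((subst_word \<phi> ^^ n) [b])) at_top sequentially"
    if "b \<in> B" for b
    using \<phi>(1) that by (auto simp: substitution_def)
  have ne: "\<phi> b \<noteq> []" if b: "b \<in> B" for b
  proof
    assume e: "\<phi> b = []"
    have z: "(subst_word \<phi> ^^ n) [] = []" for n
      by (induction n) (auto simp: subst_word_def)
    have "(subst_word \<phi> ^^ Suc n) [b] = []" for n
      using z[of n] e by (simp add: funpow_swap1 subst_word_def)
    moreover have "eventually (\<lambda>n. 1 \<le> length ((subst_word \<phi> ^^ n) [b])) sequentially"
      using grow[OF b] by (simp add: filterlim_at_top)
    ultimately show False
      unfolding eventually_sequentially by (metis le_SucI le_refl list.size(3) not_one_le_zero)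
  qed
  have pre: "map y [0..<m] \<in> lists B" for m
    using y by (auto simp: Pi_iff)
  have pre_word: "subst_word \<psi> (map (f \<circ> y) [0..<m]) = map f (subst_word \<phi> (map y [0..<m]))" for m
    using word[OF pre[of m]] by simp
  have long: "m \<le> length (subst_word \<phi> (map y [0..<m]))" for m
  proof (induction m)
    case (Suc m)
    have "\<phi> (y m) \<noteq> []" using ne y by (auto simp: Pi_iff)
    then have "0 < length (\<phi> (y m))" by simp
    with Suc show ?case by (simp add: subst_word_def del: length_greater_0_conv)
  qed simp
  show "subst_seq \<psi> (f \<circ> y) = f \<circ> y"
  proof
    fix n
    have "n < length (subst_word \<phi> (map y [0..<Suc n]))"
      using long[of "Suc n"] by linarith
    then have *: "n < length (subst_word \<phi>
        (map y [0..<(LEAST m. n < length (subst_word \<phi> (map y [0..<m])))]))"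
      by (rule LeastI[where P = "\<lambda>m. n < length (subst_word \<phi> (map y [0..<m]))"])
    have "subst_seq \<psi> (f \<circ> y) n = f (subst_seq \<phi> y n)"
      using * by (simp only: subst_seq_def pre_word length_map nth_map)
    then show "subst_seq \<psi> (f \<circ> y) n = (f \<circ> y) n"
      by (simp add: \<phi>(2))
  qed
qed

lemma substitutiveI:
  fixes B :: "'b set"
  assumes "purely_substitutive B y" "\<pi> \<in> B \<rightarrow> A"
  shows "substitutive A (\<pi> \<circ> y)"
proof -
  have B: "alphabet B" and y: "y \<in> UNIV \<rightarrow> B"
    using assms(1) by (auto simp: purely_substitutive_def)
  obtain \<phi> where \<phi>: "substitution B \<phi>" "subst_seq \<phi> y = y"
    using assms(1) by (auto simp: purely_substitutive_def)
  obtain f :: "'b \<Rightarrow> nat" where f: "inj_on f B"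
    using B finite_imp_inj_to_nat_seg[of B] by (auto simp: alphabet_def)
  have "purely_substitutive (f ` B) (f \<circ> y)"
    unfolding purely_substitutive_def using B y rename_alphabet[OF f y \<phi>]
    by (intro conjI) (auto simp: alphabet_def)
  moreover have "\<pi> \<circ> inv_into B f \<in> f ` B \<rightarrow> A" "\<pi> \<circ> y = (\<pi> \<circ> inv_into B f) \<circ> (f \<circ> y)"
    using assms(2) f y by (auto simp: fun_eq_iff Pi_iff)
  ultimately show ?thesis
    unfolding substitutive_def by blast
qed

lemma automaticI:
  fixes B :: "'b set"
  assumes "purely_automatic k B y" "\<pi> \<in> B \<rightarrow> A"
  shows "automatic k A (\<pi> \<circ> y)"
proof -
  have B: "alphabet B" "2 \<le> k" and y: "y \<in> UNIV \<rightarrow> B"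
    using assms(1) by (auto simp: purely_automatic_def)
  obtain \<phi> where \<phi>: "substitution B \<phi>" "subst_seq \<phi> y = y" and k: "constant_length k B \<phi>"
    using assms(1) by (auto simp: purely_automatic_def)
  obtain f :: "'b \<Rightarrow> nat" where f: "inj_on f B"
    using B finite_imp_inj_to_nat_seg[of B] by (auto simp: alphabet_def)
  have "constant_length k (f ` B) (\<lambda>c. map f (\<phi> (inv_into B f c)))"
    using k f by (auto simp: constant_length_def)
  then have "purely_automatic k (f ` B) (f \<circ> y)"
    unfolding purely_automatic_def using B y rename_alphabet[OF f y \<phi>]
    by (intro conjI) (auto simp: alphabet_def)
  moreover have "\<pi> \<circ> inv_into B f \<in> f ` B \<rightarrow> A" "\<pi> \<circ> y = (\<pi> \<circ> inv_into B f) \<circ> (f \<circ> y)"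
    using assms(2) f y by (auto simp: fun_eq_iff Pi_iff)
  ultimately show ?thesis
    unfolding automatic_def by blast
qed

end

theory Submission
  imports Defs
begin

text \<open>Lift the generator of the subsystem through the coding to a limit \<open>z\<close> of shifts of the fixed
  point, and desubstitute it repeatedly: \<open>z\<^sub>0 = z\<close>, and \<open>z\<^sub>n\<close> is the image \<open>\<phi>(z\<^sub>n\<^sub>+\<^sub>1)\<close> cut inside the
  image of its first letter. Look at the pairs of letters that infinitely often start some \<open>z\<^sub>n\<close>. If
  one of them also occurs further to the right in infinitely many \<open>z\<^sub>n\<close>, a fixed cut of a power of
  \<open>\<phi>\<close> produces a sequence with the same finite factors as \<open>z\<close>. Otherwise the starting pair is
  eventually the last such pair, hence each \<open>z\<^sub>n\<close> is determined by the pair above it, and the \<open>z\<^sub>n\<close>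
  are eventually periodic. In both cases the subsystem is generated by the coding of a sequence \<open>y\<close>
  some tail of which is the image of another tail of \<open>y\<close> under a power of \<open>\<phi>\<close>. Such a sequence
  becomes a fixed point after marking finitely many initial positions, or, for constant length,
  after recording a long enough window around each position.\<close>

section \<open>Tails and prefixes of sequences\<close>

definition tail :: "nat \<Rightarrow> (nat \<Rightarrow> 'a) \<Rightarrow> nat \<Rightarrow> 'a" where
  "tail m x = (\<lambda>i. x (m + i))"

lemma tail_apply [simp]: "tail m x i = x (m + i)"
  by (simp add: tail_def)

lemma tail_0 [simp]: "tail 0 x = x"
  by (simp add: tail_def)

lemma tail_tail [simp]: "tail m (tail n x) = tail (n + m) x"
  by (simp add: tail_def add.assoc)

lemma funpow_shift: "(shift ^^ n) x = tail n x"
  by (induction n arbitrary: x) (auto simp: shift_def fun_eq_iff)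

abbreviation pre :: "(nat \<Rightarrow> 'a) \<Rightarrow> nat \<Rightarrow> 'a list" where
  "pre x n \<equiv> map x [0..<n]"

lemma pre_add: "pre x (m + n) = pre x m @ pre (tail m x) n"
  by (rule nth_equalityI) (auto simp: nth_append)

lemma pre_cong: "(\<And>i. i < n \<Longrightarrow> x i = y i) \<Longrightarrow> pre x n = pre y n"
  by simp

section \<open>Words\<close>

lemma subst_word_Nil [simp]: "subst_word \<phi> [] = []"
  by (simp add: subst_word_def)

lemma subst_word_Cons [simp]: "subst_word \<phi> (a # w) = \<phi> a @ subst_word \<phi> w"
  by (simp add: subst_word_def)

lemma subst_word_append [simp]: "subst_word \<phi> (v @ w) = subst_word \<phi> v @ subst_word \<phi> w"
  by (simp add: subst_word_def)

lemma set_subst_word: "(\<And>a. set (\<phi> a) \<subseteq> A) \<Longrightarrow> set (subst_word \<phi> w) \<subseteq> A"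
  by (induction w) auto

lemma length_subst_word_ge:
  assumes "\<And>a. k \<le> length (\<phi> a)"
  shows "k * length w \<le> length (subst_word \<phi> w)"
  using assms by (induction w) (auto intro: add_mono)

lemma length_subst_word_const:
  assumes "\<And>a. length (\<phi> a) = k"
  shows "length (subst_word \<phi> w) = k * length w"
  using assms by (induction w) auto

text \<open>Quantifying over the whole letter type instead of an alphabet keeps membership
  conditions out of the calculus of images; \<open>total_extension\<close> supplies substitutions of
  this kind.\<close>

definition nonerasing :: "('a \<Rightarrow> 'b list) \<Rightarrow> bool" where
  "nonerasing \<phi> \<longleftrightarrow> (\<forall>a. \<phi> a \<noteq> [])"

lemma nonerasing_length: "nonerasing \<phi> \<Longrightarrow> 0 < length (\<phi> a)"
  by (simp add: nonerasing_def)

lemma nonerasingI: "(\<And>a. k \<le> length (\<phi> a)) \<Longrightarrow> 0 < k \<Longrightarrow> nonerasing \<phi>"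
  unfolding nonerasing_def by (metis le_zero_eq list.size(3) not_gr_zero)

lemma nonerasing_length_word: "nonerasing \<phi> \<Longrightarrow> length w \<le> length (subst_word \<phi> w)"
  using length_subst_word_ge[of 1 \<phi> w] nonerasing_length[of \<phi>] by (simp add: Suc_leI)

definition subst_comp :: "('b \<Rightarrow> 'c list) \<Rightarrow> ('a \<Rightarrow> 'b list) \<Rightarrow> 'a \<Rightarrow> 'c list" where
  "subst_comp \<sigma> \<tau> a = subst_word \<sigma> (\<tau> a)"

lemma subst_word_comp: "subst_word (subst_comp \<sigma> \<tau>) w = subst_word \<sigma> (subst_word \<tau> w)"
  by (induction w) (auto simp: subst_comp_def)

lemma nonerasing_comp: "nonerasing \<sigma> \<Longrightarrow> nonerasing \<tau> \<Longrightarrow> nonerasing (subst_comp \<sigma> \<tau>)"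
  by (metis nonerasing_def subst_comp_def nonerasing_length_word le_zero_eq length_0_conv)

definition subst_pow :: "('a \<Rightarrow> 'a list) \<Rightarrow> nat \<Rightarrow> 'a \<Rightarrow> 'a list" where
  "subst_pow \<phi> n a = (subst_word \<phi> ^^ n) [a]"

lemma subst_word_funpow_append:
  fixes \<phi> :: "'a \<Rightarrow> 'a list"
  shows "(subst_word \<phi> ^^ n) (v @ w) = (subst_word \<phi> ^^ n) v @ (subst_word \<phi> ^^ n) w"
  by (induction n) auto

lemma subst_word_pow: "subst_word (subst_pow \<phi> n) w = (subst_word \<phi> ^^ n) w"
proof (induction w)
  case Nil
  show ?case by (induction n) auto
next
  case (Cons a w)
  then show ?case
    using subst_word_funpow_append[of n \<phi> "[a]" w] by (simp add: subst_pow_def)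
qed

lemma subst_pow_0: "subst_pow \<phi> 0 = (\<lambda>a. [a])"
  by (simp add: subst_pow_def fun_eq_iff)

lemma subst_pow_1 [simp]: "subst_pow \<phi> (Suc 0) = \<phi>"
  by (simp add: subst_pow_def fun_eq_iff)

lemma subst_pow_add: "subst_pow \<phi> (m + n) = subst_comp (subst_pow \<phi> m) (subst_pow \<phi> n)"
  by (simp add: fun_eq_iff subst_comp_def subst_word_pow) (simp add: subst_pow_def funpow_add)

lemma subst_pow_mult: "subst_pow \<phi> (m * n) = subst_pow (subst_pow \<phi> m) n"
proof -
  have "subst_word (subst_pow \<phi> m) = subst_word \<phi> ^^ m"
    by (simp add: fun_eq_iff subst_word_pow)
  then show ?thesis
    by (intro ext) (simp add: subst_pow_def[of _ n] subst_pow_def[of _ "m * n"] funpow_mult mult.commute)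
qed

lemma length_subst_pow_ge:
  assumes "\<And>a. k \<le> length (\<phi> a)"
  shows "k ^ n \<le> length (subst_pow \<phi> n a)"
proof (induction n)
  case (Suc n)
  have "k * k ^ n \<le> k * length (subst_pow \<phi> n a)"
    using Suc by simp
  also have "\<dots> \<le> length (subst_word \<phi> (subst_pow \<phi> n a))"
    by (rule length_subst_word_ge) (rule assms)
  finally show ?case
    by (simp add: subst_pow_def)
qed (simp add: subst_pow_def)

lemma length_subst_pow_const:
  assumes "\<And>a. length (\<phi> a) = k"
  shows "length (subst_pow \<phi> n a) = k ^ n"
proof (induction n)
  case (Suc n)
  then show ?case
    using length_subst_word_const[of \<phi> k "subst_pow \<phi> n a"] assms by (simp add: subst_pow_def)
qed (simp add: subst_pow_def)

lemma nonerasing_pow: "nonerasing \<phi> \<Longrightarrow> nonerasing (subst_pow \<phi> n)"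
  using length_subst_pow_ge[of 1 \<phi> n] nonerasing_length[of \<phi>]
  by (intro nonerasingI[of 1]) (auto simp: Suc_leI)

lemma set_subst_pow:
  assumes "\<And>a. set (\<phi> a) \<subseteq> A" "0 < n"
  shows "set (subst_pow \<phi> n a) \<subseteq> A"
  using assms set_subst_word[of \<phi> A] by (cases n) (auto simp: subst_pow_def)

section \<open>Images of sequences\<close>

text \<open>Images of prefixes are prefixes of one another, so any long enough prefix can replace
  the least one in \<open>subst_seq\<close>.\<close>

lemma subst_seq_nth:
  assumes "nonerasing \<phi>" "i < length (subst_word \<phi> (pre x m))"
  shows "subst_seq \<phi> x i = subst_word \<phi> (pre x m) ! i"
proof -
  define l where "l = (LEAST m. i < length (subst_word \<phi> (pre x m)))"
  have l: "i < length (subst_word \<phi> (pre x l))" "l \<le> m"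
    unfolding l_def using assms(2) by (auto intro: LeastI Least_le)
  have "pre x m = pre x l @ pre (tail l x) (m - l)"
    using pre_add[of x l "m - l"] l(2) by simp
  then show ?thesis
    using l(1) by (simp add: subst_seq_def flip: l_def) (simp add: nth_append)
qed

lemma less_length_subst_pre:
  assumes "nonerasing \<phi>"
  shows "i < length (subst_word \<phi> (pre x (Suc i)))"
  using nonerasing_length_word[OF assms, of "pre x (Suc i)"] by simp

lemma subst_seq_eqI:
  assumes "nonerasing \<phi>"
    and "\<And>m i. i < length (subst_word \<phi> (pre x m)) \<Longrightarrow> w i = subst_word \<phi> (pre x m) ! i"
  shows "subst_seq \<phi> x = w"
proof
  fix i
  show "subst_seq \<phi> x i = w i"
    using subst_seq_nth[OF assms(1) less_length_subst_pre[OF assms(1)]]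
      assms(2)[OF less_length_subst_pre[OF assms(1)]] by simp
qed

lemma pre_subst_seq:
  assumes "nonerasing \<phi>"
  shows "pre (subst_seq \<phi> x) (length (subst_word \<phi> (pre x m))) = subst_word \<phi> (pre x m)"
  by (rule nth_equalityI) (auto simp: subst_seq_nth[OF assms, of _ x m])

lemma tail_subst_seq:
  assumes "nonerasing \<phi>"
  shows "tail (length (subst_word \<phi> (pre x m))) (subst_seq \<phi> x) = subst_seq \<phi> (tail m x)"
proof (rule sym, rule subst_seq_eqI[OF assms])
  fix n i
  assume i: "i < length (subst_word \<phi> (pre (tail m x) n))"
  then show "tail (length (subst_word \<phi> (pre x m))) (subst_seq \<phi> x) i
      = subst_word \<phi> (pre (tail m x) n) ! i"
    using subst_seq_nth[OF assms, of "length (subst_word \<phi> (pre x m)) + i" x "m + n"]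
    unfolding pre_add by simp
qed

lemma subst_seq_comp:
  assumes "nonerasing \<sigma>" "nonerasing \<tau>"
  shows "subst_seq (subst_comp \<sigma> \<tau>) x = subst_seq \<sigma> (subst_seq \<tau> x)"
proof (rule subst_seq_eqI[OF nonerasing_comp[OF assms]])
  fix m i
  assume "i < length (subst_word (subst_comp \<sigma> \<tau>) (pre x m))"
  then show "subst_seq \<sigma> (subst_seq \<tau> x) i = subst_word (subst_comp \<sigma> \<tau>) (pre x m) ! i"
    using subst_seq_nth[OF assms(1), of i "subst_seq \<tau> x" "length (subst_word \<tau> (pre x m))"]
    by (simp add: subst_word_comp pre_subst_seq[OF assms(2)])
qed

lemma subst_seq_cong:
  assumes "nonerasing \<phi>" "\<And>i. i < m \<Longrightarrow> x i = y i" "i < length (subst_word \<phi> (pre x m))"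
  shows "subst_seq \<phi> x i = subst_seq \<phi> y i"
proof -
  have "pre x m = pre y m"
    by (rule pre_cong) (rule assms(2))
  then show ?thesis
    using subst_seq_nth[OF assms(1)] assms(3) by metis
qed

lemma subst_seq_pow_0: "subst_seq (subst_pow \<phi> 0) x = x"
proof (rule subst_seq_eqI)
  show "nonerasing (subst_pow \<phi> 0)"
    by (simp add: nonerasing_def subst_pow_0)
qed (simp add: subst_word_pow)

lemma subst_seq_pow_fixed:
  assumes "nonerasing \<phi>" "subst_seq \<phi> x = x"
  shows "subst_seq (subst_pow \<phi> n) x = x"
proof (induction n)
  case (Suc n)
  then show ?case
    using subst_pow_add[of \<phi> n 1] subst_seq_comp[OF nonerasing_pow assms(1)] assms by simp
qed (simp add: subst_seq_pow_0)

section \<open>Cut images\<close>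

text \<open>One step of desubstitution. The strict bound places the start of \<open>w\<close> inside
  the image of \<open>v 0\<close>, so \<open>v 0\<close> is the letter from which \<open>w 0\<close>
  arises.\<close>

definition covers :: "('a \<Rightarrow> 'b list) \<Rightarrow> (nat \<Rightarrow> 'a) \<Rightarrow> (nat \<Rightarrow> 'b) \<Rightarrow> bool" where
  "covers \<tau> v w \<longleftrightarrow> (\<exists>c < length (\<tau> (v 0)). w = tail c (subst_seq \<tau> v))"

text \<open>Cuts accumulate: the image under \<open>\<sigma>\<close> of the \<open>d\<close> letters
  removed first, then \<open>c\<close> letters of the image of \<open>w 0\<close>. As
  \<open>w 0\<close> is itself a letter of \<open>\<tau> (v 0)\<close>, the total stays inside the
  image of \<open>v 0\<close>.\<close>

lemma covers_comp:
  assumes "nonerasing \<sigma>" "nonerasing \<tau>" "covers \<tau> v w" "covers \<sigma> w t"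
  shows "covers (subst_comp \<sigma> \<tau>) v t"
proof -
  obtain d where d: "d < length (\<tau> (v 0))" "w = tail d (subst_seq \<tau> v)"
    using assms(3) by (auto simp: covers_def)
  obtain c where c: "c < length (\<sigma> (w 0))" "t = tail c (subst_seq \<sigma> w)"
    using assms(4) by (auto simp: covers_def)
  let ?x = "subst_seq \<tau> v"
  let ?c = "length (subst_word \<sigma> (pre ?x d)) + c"
  have "pre ?x (length (\<tau> (v 0))) = \<tau> (v 0)"
    using pre_subst_seq[OF assms(2), of v 1] by simp
  moreover have "pre ?x (length (\<tau> (v 0)))
      = pre ?x (Suc d) @ pre (tail (Suc d) ?x) (length (\<tau> (v 0)) - Suc d)"
    using d(1) by (metis pre_add le_add_diff_inverse Suc_leI)
  ultimately have "length (subst_word \<sigma> (pre ?x (Suc d))) \<le> length (subst_word \<sigma> (\<tau> (v 0)))"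
    by (metis subst_word_append length_append le_add1)
  then have "?c < length (subst_comp \<sigma> \<tau> (v 0))"
    using c(1) d(2) by (simp add: subst_comp_def)
  moreover have "t = tail ?c (subst_seq (subst_comp \<sigma> \<tau>) v)"
    using c(2) d(2) by (simp add: subst_seq_comp[OF assms(1,2)]
        flip: tail_subst_seq[OF assms(1)])
  ultimately show ?thesis
    by (auto simp: covers_def)
qed

lemma covers_pow_self:
  assumes "nonerasing \<phi>" "covers \<phi> v v"
  shows "covers (subst_pow \<phi> n) v v"
proof (induction n)
  case 0
  show ?case
    unfolding covers_def subst_seq_pow_0 by (simp add: subst_pow_0)
next
  case (Suc n)
  then show ?case
    using covers_comp[OF nonerasing_pow[OF assms(1)] assms(1) assms(2) Suc] subst_pow_add[of \<phi> n 1]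
    by simp
qed

definition factor :: "'a list \<Rightarrow> (nat \<Rightarrow> 'a) \<Rightarrow> bool" where
  "factor w x \<longleftrightarrow> (\<exists>m. \<forall>i < length w. x (m + i) = w ! i)"

lemma factor_sublist: "factor (u @ v @ w) x \<Longrightarrow> factor v x"
  unfolding factor_def
proof (elim exE)
  fix m
  assume *: "\<forall>i<length (u @ v @ w). x (m + i) = (u @ v @ w) ! i"
  have "x (m + length u + i) = v ! i" if "i < length v" for i
    using *[rule_format, of "length u + i"] that by (simp add: nth_append add.assoc)
  then show "\<exists>m. \<forall>i<length v. x (m + i) = v ! i"
    by blast
qed

text \<open>An occurrence at position 0 would not do: its image may be cut.\<close>

lemma covers_occurrence:
  assumes "nonerasing \<tau>" "covers \<tau> v w" "1 \<le> j" "v j = a" "v (Suc j) = b"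
  shows "\<exists>m\<ge>1. \<forall>i < length (subst_word \<tau> [a, b]). w (m + i) = subst_word \<tau> [a, b] ! i"
proof -
  obtain c where c: "c < length (\<tau> (v 0))" "w = tail c (subst_seq \<tau> v)"
    using assms(2) by (auto simp: covers_def)
  let ?l = "length (subst_word \<tau> (pre v j))"
  have "length (\<tau> (v 0)) \<le> ?l"
    using assms(3) pre_add[of v 1 "j - 1"] by simp
  then have l: "c < ?l"
    using c(1) by simp
  have "w (?l - c + i) = subst_word \<tau> [a, b] ! i" if i: "i < length (subst_word \<tau> [a, b])" for i
  proof -
    have "w (?l - c + i) = tail ?l (subst_seq \<tau> v) i"
      using l c(2) by simp
    also have "\<dots> = subst_seq \<tau> (tail j v) i"
      by (simp only: tail_subst_seq[OF assms(1)])
    also have "\<dots> = subst_word \<tau> (pre (tail j v) 2) ! i"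
      using i assms(4,5) by (intro subst_seq_nth[OF assms(1)]) (simp add: numeral_2_eq_2)
    finally show ?thesis
      using assms(4,5) by (simp add: numeral_2_eq_2)
  qed
  then show ?thesis
    using l by (intro exI[of _ "?l - c"]) auto
qed

lemma covers_factor:
  assumes "nonerasing \<tau>" "covers \<tau> v w" "1 \<le> j" "v j = a" "v (Suc j) = b"
  shows "factor (subst_word \<tau> [a, b]) w"
  using covers_occurrence[OF assms] unfolding factor_def by blast

text \<open>The cut leaves at least the last letter of \<open>\<tau> (v 0)\<close>, and all of
  \<open>\<tau> (v 1)\<close> follows; hence the bound on \<open>n\<close>.\<close>

lemma covers_prefix:
  assumes "nonerasing \<tau>" "covers \<tau> v w" "n \<le> Suc (length (\<tau> (v 1)))"
  shows "\<exists>s t. subst_word \<tau> [v 0, v 1] = s @ pre w n @ t \<and> length s < length (\<tau> (v 0))"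
proof -
  obtain c where c: "c < length (\<tau> (v 0))" "w = tail c (subst_seq \<tau> v)"
    using assms(2) by (auto simp: covers_def)
  let ?W = "subst_word \<tau> [v 0, v 1]"
  have W: "pre (subst_seq \<tau> v) (length ?W) = ?W"
    using pre_subst_seq[OF assms(1), of v 2] by (simp add: numeral_2_eq_2)
  have "pre (subst_seq \<tau> v) (c + (n + (length ?W - c - n)))
     = pre (subst_seq \<tau> v) c @ pre w n @ pre (tail n w) (length ?W - c - n)"
    using c(2) by (simp only: pre_add)
  moreover have "c + (n + (length ?W - c - n)) = length ?W"
    using c(1) assms(3) by simp
  ultimately have "?W = pre (subst_seq \<tau> v) c @ pre w n @ pre (tail n w) (length ?W - c - n)"
    using W by metis
  then show ?thesis
    using c(1) by (metis diff_zero length_map length_upt)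
qed

section \<open>Orbit closures\<close>

text \<open>Membership in the orbit closure expressed through words alone; see
  \<open>orbit_closure_iff\<close>.\<close>

definition limit_of :: "(nat \<Rightarrow> 'a) \<Rightarrow> (nat \<Rightarrow> 'a) \<Rightarrow> bool" where
  "limit_of y x \<longleftrightarrow> (\<forall>n. \<exists>m. \<forall>i<n. y i = x (m + i))"

lemma limit_ofI:
  assumes "\<And>n. factor (pre y n) x"
  shows "limit_of y x"
  unfolding limit_of_def
proof
  fix n
  show "\<exists>m. \<forall>i<n. y i = x (m + i)"
    using assms[of n] unfolding factor_def by (metis add_0 diff_zero length_map length_upt nth_map_upt)
qed

lemma limit_of_trans:
  assumes "limit_of z y" "limit_of y x"
  shows "limit_of z x"
  unfolding limit_of_def
proof
  fix n
  obtain m where m: "\<forall>i<n. z i = y (m + i)"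
    using assms(1) unfolding limit_of_def by blast
  obtain l where l: "\<forall>i<m + n. y i = x (l + i)"
    using assms(2) unfolding limit_of_def by blast
  have "\<forall>i<n. z i = x (l + m + i)"
    using m l by (simp add: add.assoc)
  then show "\<exists>m. \<forall>i<n. z i = x (m + i)" by blast
qed

lemma limit_of_coding: "limit_of z x \<Longrightarrow> limit_of (\<pi> \<circ> z) (\<pi> \<circ> x)"
  unfolding limit_of_def comp_def by metis

lemma limit_of_in:
  assumes "limit_of y x" "x \<in> UNIV \<rightarrow> A"
  shows "y \<in> UNIV \<rightarrow> A"
proof
  fix i
  obtain m where "\<forall>j<Suc i. y j = x (m + j)"
    using assms(1) unfolding limit_of_def by blast
  then show "y i \<in> A"
    using assms(2) by auto
qed

text \<open>A basic open set restricts finitely many coordinates, so the cylinders given by prefixes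
  of \<open>y\<close> form a neighbourhood base at \<open>y\<close>.\<close>

lemma orbit_closure_iff:
  assumes x: "x \<in> UNIV \<rightarrow> A"
  shows "y \<in> orbit_closure A x \<longleftrightarrow> limit_of y x"
proof
  assume y: "y \<in> orbit_closure A x"
  then have yA: "y i \<in> A" for i
    by (auto simp: orbit_closure_def in_closure_of seq_topology_def PiE_iff)
  show "limit_of y x"
    unfolding limit_of_def
  proof
    fix n
    let ?U = "\<lambda>i. if i < n then {y i} else A"
    have "{i \<in> UNIV. ?U i \<noteq> A} \<subseteq> {..<n}" by auto
    then have "finite {i \<in> UNIV. ?U i \<noteq> A}"
      by (rule finite_subset) simp
    then have "openin (seq_topology A) (PiE UNIV ?U)"
      unfolding seq_topology_def using yA by (intro product_topology_basis) (auto intro: finite_subset)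
    moreover have "y \<in> PiE UNIV ?U"
      using yA by (auto simp: PiE_iff)
    ultimately obtain m where "tail m x \<in> PiE UNIV ?U"
      using y by (auto simp: orbit_closure_def in_closure_of funpow_shift)
    then have "tail m x i \<in> ?U i" for i
      by (auto simp: PiE_iff)
    then have "\<forall>i<n. y i = x (m + i)"
      by (metis singletonD tail_apply)
    then show "\<exists>m. \<forall>i<n. y i = x (m + i)" ..
  qed
next
  assume lim: "limit_of y x"
  show "y \<in> orbit_closure A x"
    unfolding orbit_closure_def in_closure_of
  proof (intro conjI allI impI)
    show "y \<in> topspace (seq_topology A)"
      using limit_of_in[OF lim x] by (auto simp: seq_topology_def PiE_iff)
  next
    fix T
    assume T: "y \<in> T \<and> openin (seq_topology A) T"
    then obtain U where U: "finite {i. U i \<noteq> A}" "y \<in> PiE UNIV U" "PiE UNIV U \<subseteq> T"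
      unfolding seq_topology_def openin_product_topology_alt by auto
    obtain n where n: "\<And>i. U i \<noteq> A \<Longrightarrow> i < n"
      using U(1) by (auto simp: finite_nat_set_iff_bounded)
    obtain m where "\<forall>i<n. y i = x (m + i)"
      using lim unfolding limit_of_def by blast
    then have "tail m x \<in> PiE UNIV U"
      using n U(2) x by (auto simp: PiE_iff Pi_iff) metis
    then show "\<exists>z. z \<in> range (\<lambda>n. (shift ^^ n) x) \<and> z \<in> T"
      using U(3) by (auto simp: funpow_shift)
  qed
qed

lemma orbit_closure_eqI:
  assumes "x \<in> UNIV \<rightarrow> A" "limit_of x y" "limit_of y x"
  shows "orbit_closure A x = orbit_closure A y"
proof -
  have y: "y \<in> UNIV \<rightarrow> A"
    by (rule limit_of_in[OF assms(3,1)])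
  have "limit_of z x \<longleftrightarrow> limit_of z y" for z
    using assms(2,3) limit_of_trans by metis
  then show ?thesis
    by (simp add: set_eq_iff orbit_closure_iff[OF assms(1)] orbit_closure_iff[OF y])
qed

section \<open>Compactness of the space of sequences\<close>

lemma cluster_sequence:
  fixes w :: "nat \<Rightarrow> nat \<Rightarrow> 'a"
  assumes "finite A" "\<And>k i. w k i \<in> A"
  obtains z where "\<And>n. infinite {k. \<forall>i<n. w k i = z i}"
proof -
  \<comment> \<open>Koenig's lemma: a good word is a prefix of infinitely many \<open>w k\<close>,
    and by pigeonhole on the finite set \<open>A\<close> it has a good extension by one letter.
    Keeping infinitely many indices allows \<open>k\<close> to be taken arbitrarily large
    later.\<close>
  define good where "good u \<longleftrightarrow> infinite {k. pre (w k) (length u) = u}" for u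
  have step: "\<exists>a. good (u @ [a])" if "good u" for u
  proof (rule ccontr)
    assume "\<not> (\<exists>a. good (u @ [a]))"
    then have "finite (\<Union>a\<in>A. {k. pre (w k) (length (u @ [a])) = u @ [a]})"
      using assms(1) by (auto simp: good_def)
    moreover have "{k. pre (w k) (length u) = u}
        \<subseteq> (\<Union>a\<in>A. {k. pre (w k) (length (u @ [a])) = u @ [a]})"
      using assms(2) by auto
    ultimately show False
      using that by (auto simp: good_def dest: finite_subset)
  qed
  have "\<exists>f. \<forall>n. (good (f n) \<and> length (f n) = n) \<and> (\<exists>a. f (Suc n) = f n @ [a])"
  proof (rule dependent_nat_choice)
    show "\<exists>u. good u \<and> length u = 0"
      by (auto simp: good_def)
    show "\<exists>y. (good y \<and> length y = Suc n) \<and> (\<exists>a. y = u @ [a])" if "good u \<and> length u = n" for u n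
      using step[of u] that by auto
  qed
  then obtain f where f: "\<And>n. good (f n)" "\<And>n. length (f n) = n" "\<And>n. \<exists>a. f (Suc n) = f n @ [a]"
    by blast
  define z where "z n = f (Suc n) ! n" for n
  have fz: "f n = pre z n" for n
  proof (induction n)
    case 0
    then show ?case using f(2)[of 0] by simp
  next
    case (Suc n)
    then show ?case using f(2)[of n] f(3)[of n] by (auto simp: z_def nth_append)
  qed
  show ?thesis
  proof
    fix n
    have "{k. \<forall>i<n. w k i = z i} = {k. pre (w k) (length (f n)) = f n}"
      unfolding fz by auto
    then show "infinite {k. \<forall>i<n. w k i = z i}"
      using f(1)[of n] by (simp add: good_def)
  qed
qed

text \<open>The shifts of \<open>x\<close> whose codings approximate \<open>y\<close> have a cluster
  point, and its coding is \<open>y\<close> by continuity.\<close>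

lemma limit_of_coding_lift:
  assumes "finite B" "x \<in> UNIV \<rightarrow> B" "limit_of y (\<pi> \<circ> x)"
  obtains z where "limit_of z x" "y = \<pi> \<circ> z"
proof -
  obtain m where m: "\<And>n i. i < n \<Longrightarrow> y i = \<pi> (x (m n + i))"
    using assms(3) unfolding limit_of_def comp_def by metis
  have "x (m k + i) \<in> B" for k i
    using assms(2) by auto
  then obtain z where z: "\<And>n. infinite {k. \<forall>i<n. x (m k + i) = z i}"
    using cluster_sequence[of B "\<lambda>k i. x (m k + i)"] assms(1) by blast
  have large: "\<exists>k\<ge>n. \<forall>i<n. x (m k + i) = z i" for n
    using z[of n] unfolding infinite_nat_iff_unbounded_le by blast
  show ?thesis
  proof
    show "limit_of z x"
      unfolding limit_of_def using large by metis
    show "y = \<pi> \<circ> z"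
    proof
      fix i
      \<comment> \<open>The shift by \<open>m k\<close> approximates \<open>y\<close> on the first
        \<open>k\<close> positions only, so \<open>k\<close> has to exceed \<open>i\<close>.\<close>
      obtain k where "k \<ge> Suc i" "\<forall>j<Suc i. x (m k + j) = z j"
        using large by blast
      then show "y i = (\<pi> \<circ> z) i"
        using m[of i k] by simp
    qed
  qed
qed

section \<open>Desubstitution of limits of a fixed point\<close>

lemma block_position:
  assumes "nonerasing \<phi>"
  shows "\<exists>b c. n = length (subst_word \<phi> (pre x b)) + c \<and> c < length (\<phi> (x b))"
proof (induction n)
  case 0
  show ?case
    using nonerasing_length[OF assms, of "x 0"] by (intro exI[of _ 0]) auto
next
  case (Suc n)
  then obtain b c where bc: "n = length (subst_word \<phi> (pre x b)) + c" "c < length (\<phi> (x b))"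
    by blast
  show ?case
  proof (cases "Suc c < length (\<phi> (x b))")
    case True
    then show ?thesis using bc by (intro exI[of _ b] exI[of _ "Suc c"]) auto
  next
    case False
    then show ?thesis
      using bc nonerasing_length[OF assms, of "x (Suc b)"]
      by (intro exI[of _ "Suc b"] exI[of _ 0]) auto
  qed
qed

text \<open>Each approximating shift of the fixed point starts at some offset in the image of a
  letter. Offsets are bounded, so along a subsequence the offset is constant and the shifts starting
  at those letters converge; this gives the cut and \<open>v\<close>.\<close>

lemma limit_of_desubstitute:
  assumes "finite A" "x \<in> UNIV \<rightarrow> A" "nonerasing \<phi>" "subst_seq \<phi> x = x" "limit_of z x"
  shows "\<exists>v. limit_of v x \<and> covers \<phi> v z"
proof -
  obtain m where m: "\<And>n i. i < n \<Longrightarrow> z i = x (m n + i)"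
    using assms(5) unfolding limit_of_def by metis
  obtain b c where bc: "\<And>n. m n = length (subst_word \<phi> (pre x (b n))) + c n"
      "\<And>n. c n < length (\<phi> (x (b n)))"
  proof -
    have "\<forall>n. \<exists>b c. m n = length (subst_word \<phi> (pre x b)) + c \<and> c < length (\<phi> (x b))"
      using block_position[OF assms(3)] by blast
    then show ?thesis
      using that unfolding choice_iff by blast
  qed
  define L where "L = Max ((length \<circ> \<phi>) ` A)"
  have "c n < L" for n
  proof -
    have "length (\<phi> (x (b n))) \<le> L"
      unfolding L_def using assms(1,2) by (intro Max_ge) auto
    then show ?thesis using bc(2)[of n] by simp
  qed
  \<comment> \<open>The offset is repeated in every coordinate, so that one compactness argument
    settles both the offset and the limit sequence.\<close>
  then have "(c k, x (b k + i)) \<in> {..<L} \<times> A" for k i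
    using assms(2) by auto
  then obtain p where p: "\<And>n. infinite {k. \<forall>i<n. (c k, x (b k + i)) = p i}"
    using cluster_sequence[of "{..<L} \<times> A" "\<lambda>k i. (c k, x (b k + i))"] assms(1) by blast
  have large: "\<exists>k\<ge>n. \<forall>i<n. (c k, x (b k + i)) = p i" for n
    using p[of n] unfolding infinite_nat_iff_unbounded_le by blast
  define v where "v = snd \<circ> p"
  define d where "d = fst (p 0)"
  have approx: "\<exists>k\<ge>n. c k = d \<and> (\<forall>i<n. x (b k + i) = v i)" if "0 < n" for n
    using large[of n] that unfolding v_def d_def by (metis comp_apply fst_conv snd_conv)
  have "limit_of v x"
    unfolding limit_of_def
  proof
    fix n
    show "\<exists>m. \<forall>i<n. v i = x (m + i)"
      using approx[of "Suc n"] by (metis less_Suc_eq zero_less_Suc)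
  qed
  moreover have "d < length (\<phi> (v 0))"
  proof -
    obtain k where "c k = d" "x (b k) = v 0"
      using approx[of 1] by auto
    then show ?thesis
      using bc(2)[of k] by simp
  qed
  moreover have "z = tail d (subst_seq \<phi> v)"
  proof
    fix i
    obtain k where k: "k \<ge> Suc (d + i)" "c k = d" "\<And>j. j < Suc (d + i) \<Longrightarrow> x (b k + j) = v j"
      using approx[of "Suc (d + i)"] by auto
    have "z i = x (length (subst_word \<phi> (pre x (b k))) + (d + i))"
      using m[of i k] bc(1)[of k] k(1,2) by (simp add: add.assoc)
    also have "\<dots> = tail (length (subst_word \<phi> (pre x (b k)))) (subst_seq \<phi> x) (d + i)"
      by (simp add: assms(4))
    also have "\<dots> = subst_seq \<phi> (tail (b k) x) (d + i)"
      by (simp only: tail_subst_seq[OF assms(3)])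
    also have "\<dots> = subst_seq \<phi> v (d + i)"
      by (rule subst_seq_cong[OF assms(3) _ less_length_subst_pre[OF assms(3)]])
        (use k(3) in auto)
    finally show "z i = tail d (subst_seq \<phi> v) i"
      by simp
  qed
  ultimately show ?thesis
    by (auto simp: covers_def)
qed

section \<open>Self-reproducing pairs of letters\<close>

text \<open>The bound on \<open>s\<close> means that the occurrence can be brought to the front by a
  cut in the sense of \<open>covers\<close>.\<close>

definition reproduces :: "('a \<Rightarrow> 'a list) \<Rightarrow> 'a \<Rightarrow> 'a \<Rightarrow> bool" where
  "reproduces \<tau> a b \<longleftrightarrow>
     (\<exists>s t. subst_word \<tau> [a, b] = s @ [a, b] @ t \<and> length s < length (\<tau> a))"

lemma reproduces_comp:
  assumes "reproduces \<sigma> a b" "reproduces \<tau> a b"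
  shows "reproduces (subst_comp \<sigma> \<tau>) a b"
proof -
  obtain s t where st: "subst_word \<tau> [a, b] = s @ [a, b] @ t" "length s < length (\<tau> a)"
    using assms(2) by (auto simp: reproduces_def)
  obtain s' t' where st': "subst_word \<sigma> [a, b] = s' @ [a, b] @ t'" "length s' < length (\<sigma> a)"
    using assms(1) by (auto simp: reproduces_def)
  have "subst_word (subst_comp \<sigma> \<tau>) [a, b] = subst_word \<sigma> s @ subst_word \<sigma> [a, b] @ subst_word \<sigma> t"
    unfolding subst_word_comp st(1) by simp
  then have "subst_word (subst_comp \<sigma> \<tau>) [a, b]
      = (subst_word \<sigma> s @ s') @ [a, b] @ (t' @ subst_word \<sigma> t)"
    unfolding st' by simp
  moreover have "length (subst_word \<sigma> s @ s') < length (subst_comp \<sigma> \<tau> a)"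
  proof -
    \<comment> \<open>Since the occurrence starts inside \<open>\<tau> a\<close>, its first letter
      lies there too: \<open>s\<close> followed by \<open>a\<close> is a prefix of
      \<open>\<tau> a\<close>. This bounds the accumulated cut.\<close>
    have "take (Suc (length s)) (\<tau> a @ \<tau> b) = s @ [a]"
      using st(1) by simp
    then have "take (Suc (length s)) (\<tau> a) = s @ [a]"
      using st(2) by simp
    then obtain r where "\<tau> a = (s @ [a]) @ r"
      by (metis append_take_drop_id)
    then show ?thesis
      using st'(2) by (simp add: subst_comp_def)
  qed
  ultimately show ?thesis
    unfolding reproduces_def by blast
qed

lemma reproduces_pow:
  assumes "reproduces \<tau> a b" "1 \<le> n"
  shows "reproduces (subst_pow \<tau> n) a b"
  using assms(2)
proof (induction n rule: nat_induct_at_least)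
  case base
  then show ?case using assms(1) by simp
next
  case (Suc n)
  then show ?case
    using reproduces_comp[OF assms(1) Suc.IH] subst_pow_add[of \<tau> 1 n] by simp
qed

lemma reproduces_factor:
  assumes "reproduces \<phi> a b" "m \<le> n"
  shows "\<exists>s t. subst_word (subst_pow \<phi> n) [a, b] = s @ subst_word (subst_pow \<phi> m) [a, b] @ t"
  using assms(2)
proof (induction n rule: dec_induct)
  case base
  show ?case by (metis append_Nil append_Nil2)
next
  case (step n)
  obtain s t where st: "subst_word \<phi> [a, b] = s @ [a, b] @ t"
    using assms(1) by (auto simp: reproduces_def)
  obtain s' t' where st': "subst_word (subst_pow \<phi> n) [a, b] = s' @ subst_word (subst_pow \<phi> m) [a, b] @ t'"
    using step by blast
  have "subst_word (subst_pow \<phi> (Suc n)) [a, b] = subst_word (subst_pow \<phi> n) (subst_word \<phi> [a, b])"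
    using subst_pow_add[of \<phi> n 1] subst_word_comp[of "subst_pow \<phi> n" \<phi> "[a, b]"] by simp
  also have "\<dots> = subst_word (subst_pow \<phi> n) s @ subst_word (subst_pow \<phi> n) [a, b] @ subst_word (subst_pow \<phi> n) t"
    unfolding st by simp
  also have "\<dots> = (subst_word (subst_pow \<phi> n) s @ s') @ subst_word (subst_pow \<phi> m) [a, b]
      @ (t' @ subst_word (subst_pow \<phi> n) t)"
    unfolding st' by simp
  finally show ?case by blast
qed

lemma covers_reproduces:
  assumes "nonerasing \<tau>" "covers \<tau> v w" "v 0 = w 0" "v 1 = w 1"
  shows "reproduces \<tau> (w 0) (w 1)"
proof -
  have "2 \<le> Suc (length (\<tau> (v 1)))"
    using nonerasing_length[OF assms(1), of "v 1"] by linarith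
  then show ?thesis
    using covers_prefix[OF assms(1,2), of 2] assms(3,4)
    by (auto simp: reproduces_def numeral_2_eq_2)
qed

text \<open>Choose an exponent for each of the finitely many pairs that reproduce themselves under
  some power. Reproduction passes to multiples of the exponent, so the product serves all pairs; the
  factor \<open>r\<close> keeps the images long.\<close>

lemma exists_uniform_power:
  fixes \<phi> :: "'a \<Rightarrow> 'a list"
  assumes "finite A" "1 \<le> r" "\<And>a. 3 \<le> length (subst_pow \<phi> r a)"
  obtains q where "1 \<le> q" "\<And>a. 3 \<le> length (subst_pow \<phi> q a)"
    "\<And>a b m. a \<in> A \<Longrightarrow> b \<in> A \<Longrightarrow> 1 \<le> m \<Longrightarrow> reproduces (subst_pow \<phi> m) a b
       \<Longrightarrow> reproduces (subst_pow \<phi> q) a b"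
proof -
  define S where "S = {e \<in> A \<times> A. \<exists>m\<ge>1. reproduces (subst_pow \<phi> m) (fst e) (snd e)}"
  have "finite S"
    using assms(1) by (auto simp: S_def)
  have "\<forall>e\<in>S. \<exists>m\<ge>1. reproduces (subst_pow \<phi> m) (fst e) (snd e)"
    by (auto simp: S_def)
  then obtain f where f: "\<And>e. e \<in> S \<Longrightarrow> 1 \<le> f e"
      "\<And>e. e \<in> S \<Longrightarrow> reproduces (subst_pow \<phi> (f e)) (fst e) (snd e)"
    by metis
  define q where "q = r * prod f S"
  have "1 \<le> prod f S"
    using f(1) by (rule prod_ge_1)
  then have q1: "1 \<le> q"
    using assms(2) by (simp add: q_def)
  show ?thesis
  proof
    show "1 \<le> q" by (fact q1)
    show "3 \<le> length (subst_pow \<phi> q a)" for a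
    proof -
      have "3 ^ 1 \<le> (3 :: nat) ^ prod f S"
        using \<open>1 \<le> prod f S\<close> by (intro power_increasing) auto
      also have "\<dots> \<le> length (subst_pow \<phi> q a)"
        unfolding q_def subst_pow_mult by (rule length_subst_pow_ge) (rule assms(3))
      finally show ?thesis by simp
    qed
    show "reproduces (subst_pow \<phi> q) a b"
      if "a \<in> A" "b \<in> A" "1 \<le> m" "reproduces (subst_pow \<phi> m) a b" for a b m
    proof -
      have e: "(a, b) \<in> S"
        using that by (auto simp: S_def)
      then have "f (a, b) dvd q"
        unfolding q_def using \<open>finite S\<close> by (simp add: dvd_prodI)
      then obtain l where l: "q = f (a, b) * l" by blast
      then have "1 \<le> l"
        using q1 by (cases l) auto
      then show ?thesis
        using reproduces_pow[of "subst_pow \<phi> (f (a, b))" a b l] f(2)[OF e]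
        by (simp add: l subst_pow_mult)
    qed
  qed
qed

text \<open>Starting from \<open>ab\<close>, repeatedly apply \<open>\<tau>\<close> and drop as many
  letters as \<open>s\<close> has. Each word is a prefix of the next, and \<open>z\<close> is their
  limit.\<close>

lemma exists_self_covering:
  fixes \<tau> :: "'a \<Rightarrow> 'a list"
  assumes len: "\<And>a. 2 \<le> length (\<tau> a)"
    and eq: "subst_word \<tau> [a, b] = s @ [a, b] @ t" and s: "length s < length (\<tau> a)"
  obtains z where "z = tail (length s) (subst_seq \<tau> z)" "z 0 = a" "z 1 = b"
proof -
  have ne: "nonerasing \<tau>"
    using nonerasingI[of 2 \<tau>] len by simp
  define w where "w m = ((\<lambda>u. drop (length s) (subst_word \<tau> u)) ^^ m) [a, b]" for m
  have w0: "w 0 = [a, b]" and wS: "\<And>m. w (Suc m) = drop (length s) (subst_word \<tau> (w m))"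
    by (simp_all add: w_def)
  have step: "\<exists>u. w (Suc m) = w m @ u" for m
  proof (induction m)
    case 0
    show ?case
      using eq by (simp add: w0 wS)
  next
    case (Suc m)
    then obtain u where u: "w (Suc m) = w m @ u" by blast
    have "w (Suc (Suc m)) = drop (length s) (subst_word \<tau> (w m @ u))"
      by (simp only: wS[of "Suc m"] u)
    then show ?case
      by (simp add: wS[of m])
  qed
  have prefix: "\<exists>u. w n = w m @ u" if "m \<le> n" for m n
    using that
  proof (induction n rule: dec_induct)
    case (step n)
    then show ?case
      using \<open>\<exists>u. w (Suc n) = w n @ u\<close> by (metis append_assoc)
  qed simp
  \<comment> \<open>The cut leaves at least one letter of \<open>\<tau> a\<close>, and the letters
    after the first at least double in number.\<close>
  have long: "m + 2 \<le> length (w m)" for m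
  proof (induction m)
    case (Suc m)
    obtain u where u: "w m = a # b # u"
      using prefix[of 0 m] by (auto simp: w0)
    have "2 * length (b # u) \<le> length (subst_word \<tau> (b # u))"
      by (rule length_subst_word_ge) (rule len)
    then show ?case
      using Suc s u by (simp add: wS)
  qed (simp add: w0)
  define z where "z n = w n ! n" for n
  have z: "w m ! i = z i" if "i < length (w m)" for m i
  proof (cases "m \<le> i")
    case True
    then show ?thesis
      using prefix[of m i] that by (auto simp: z_def nth_append)
  next
    case False
    then show ?thesis
      using prefix[of i m] long[of i] by (auto simp: z_def nth_append)
  qed
  have wz: "w m = pre z (length (w m))" for m
    by (rule nth_equalityI) (auto simp: z)
  show ?thesis
  proof
    show "z 0 = a" "z 1 = b"
      using z[of 0 0] z[of 1 0] by (auto simp: w0)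
    show "z = tail (length s) (subst_seq \<tau> z)"
    proof
      fix i
      have i: "i < length (w (Suc i))"
        using long[of "Suc i"] by simp
      then have *: "length s + i < length (subst_word \<tau> (pre z (length (w i))))"
        using wz[of i] by (simp add: wS)
      have "z i = drop (length s) (subst_word \<tau> (w i)) ! i"
        using z[OF i] by (simp add: wS)
      also have "\<dots> = subst_word \<tau> (pre z (length (w i))) ! (length s + i)"
        using * wz[of i] by (simp add: nth_drop)
      finally show "z i = tail (length s) (subst_seq \<tau> z) i"
        using subst_seq_nth[OF ne *] by simp
    qed
  qed
qed

section \<open>Towers of desubstitutions\<close>

locale desubstitution_tower =
  fixes \<phi> :: "'a \<Rightarrow> 'a list" and A :: "'a set" and zs :: "nat \<Rightarrow> nat \<Rightarrow> 'a" and cs :: "nat \<Rightarrow> nat"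
  assumes length_ge: "\<And>a. 3 \<le> length (\<phi> a)"
    and finite_alphabet: "finite A"
    and zs_in: "\<And>n i. zs n i \<in> A"
    and cs_less: "\<And>n. cs n < length (\<phi> (zs (Suc n) 0))"
    and zs_eq: "\<And>n. zs n = tail (cs n) (subst_seq \<phi> (zs (Suc n)))"
begin

text \<open>A pair is needed because the cut may leave a single letter of the first image; the next
  letter then comes from the second image. This is also why the bound in
  \<open>subst_seq_lead_cong\<close> is not strict.\<close>

definition lead :: "nat \<Rightarrow> 'a \<times> 'a" where
  "lead n = (zs n 0, zs n 1)"

lemma nonerasing: "nonerasing \<phi>"
  using nonerasingI[of 3 \<phi>] length_ge by simp

lemma zs_covers: "covers (subst_pow \<phi> i) (zs (n + i)) (zs n)"
proof (induction i)
  case 0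
  show ?case
    unfolding covers_def subst_seq_pow_0 by (simp add: subst_pow_0)
next
  case (Suc i)
  have "covers \<phi> (zs (Suc (n + i))) (zs (n + i))"
    unfolding covers_def using cs_less zs_eq by blast
  then show ?case
    using covers_comp[OF nonerasing_pow[OF nonerasing] nonerasing _ Suc] subst_pow_add[of \<phi> i 1]
    by simp
qed

lemma lead_infinitely_often: "\<exists>e. infinite {n. lead n = e}"
proof -
  have "finite (range lead)"
    by (rule finite_subset[of _ "A \<times> A"]) (auto simp: lead_def zs_in finite_alphabet)
  then obtain m where "infinite {n \<in> UNIV. lead n = lead m}"
    using pigeonhole_infinite[of UNIV lead] by blast
  then show ?thesis
    by (intro exI[of _ "lead m"]) simp
qed

lemma subst_seq_lead_cong:
  assumes "lead (Suc n) = lead (Suc m)" "i \<le> length (\<phi> (zs (Suc m) 0))"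
  shows "subst_seq \<phi> (zs (Suc n)) i = subst_seq \<phi> (zs (Suc m)) i"
proof -
  have *: "zs (Suc n) j = zs (Suc m) j" if "j < 2" for j
    using assms(1) that by (cases j) (auto simp: lead_def)
  have "i < length (subst_word \<phi> (pre (zs (Suc n)) 2))"
    using assms nonerasing_length[OF nonerasing, of "zs (Suc m) 1"]
    by (auto simp: numeral_2_eq_2 lead_def simp del: length_greater_0_conv)
  then show ?thesis
    using subst_seq_cong[OF nonerasing, of 2 "zs (Suc n)" "zs (Suc m)"] * by blast
qed

text \<open>If the leading pair is the last pair from \<open>I\<close>, the pair above it determines both the cut and
  the pair.\<close>

lemma cut_determined:
  assumes I: "\<And>n. n1 \<le> n \<Longrightarrow> lead n \<in> I"
    and last: "\<And>n j. n1 \<le> n \<Longrightarrow> 1 \<le> j \<Longrightarrow> (zs n j, zs n (Suc j)) \<notin> I"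
    and n: "n1 \<le> n" "n1 \<le> m" and eq: "lead (Suc n) = lead (Suc m)"
  shows "cs n = cs m \<and> lead n = lead m"
proof -
  have *: "\<not> cs n < cs m" if "n1 \<le> n" "n1 \<le> m" and eq: "lead (Suc n) = lead (Suc m)" for n m
  proof
    \<comment> \<open>With the smaller cut at level \<open>n\<close>, the leading pair of
      \<open>zs m\<close> would reappear in \<open>zs n\<close> at position
      \<open>cs m - cs n\<close>, which \<open>last\<close> forbids.\<close>
    assume less: "cs n < cs m"
    have same: "zs n (cs m - cs n + j) = zs m j" if "j \<le> 1" for j
    proof -
      have "zs n (cs m - cs n + j) = subst_seq \<phi> (zs (Suc n)) (cs m + j)"
        using less by (subst zs_eq) simp
      also have "\<dots> = subst_seq \<phi> (zs (Suc m)) (cs m + j)"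
        using cs_less[of m] that by (intro subst_seq_lead_cong[OF eq]) simp
      also have "\<dots> = zs m j"
        by (subst zs_eq[of m]) simp
      finally show ?thesis .
    qed
    show False
      using last[of n "cs m - cs n"] I[of m] that(1,2) same[of 0] same[of 1] less
      by (simp add: lead_def Suc_le_eq)
  qed
  have c: "cs n = cs m"
    using *[of n m] *[of m n] n eq by simp
  have "zs n j = zs m j" if "j \<le> 1" for j
  proof -
    have "zs n j = subst_seq \<phi> (zs (Suc n)) (cs m + j)"
      by (subst zs_eq) (simp add: c)
    also have "\<dots> = subst_seq \<phi> (zs (Suc m)) (cs m + j)"
      using cs_less[of m] that by (intro subst_seq_lead_cong[OF eq]) simp
    also have "\<dots> = zs m j"
      by (subst zs_eq[of m]) simp
    finally show ?thesis .
  qed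
  then show ?thesis
    using c by (simp add: lead_def)
qed

text \<open>Equality of leading pairs at two levels propagates downwards by
  \<open>cut_determined\<close>. A pair leading infinitely often therefore makes the leading pairs
  periodic, then the cuts, then the sequences.\<close>

lemma zs_periodic:
  assumes I: "\<And>n. n1 \<le> n \<Longrightarrow> lead n \<in> I"
    and last: "\<And>n j. n1 \<le> n \<Longrightarrow> 1 \<le> j \<Longrightarrow> (zs n j, zs n (Suc j)) \<notin> I"
  obtains p where "1 \<le> p" "\<And>n. n1 \<le> n \<Longrightarrow> zs (n + p) = zs n"
proof -
  have down: "lead n = lead m" if "lead (n + i) = lead (m + i)" "n1 \<le> n" "n1 \<le> m" for n m i
    using that(1)
  proof (induction i)
    case (Suc i)
    then show ?case
      using cut_determined[OF I last, where n = "n + i" and m = "m + i"] that(2,3) by simp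
  qed simp
  obtain e where e: "infinite {n. lead n = e}"
    using lead_infinitely_often by blast
  have often: "\<exists>n\<ge>l. lead n = e" for l
    using e unfolding infinite_nat_iff_unbounded_le by blast
  obtain i where i: "n1 \<le> i" "lead i = e"
    using often by blast
  obtain j where j: "Suc i \<le> j" "lead j = e"
    using often by blast
  define p where "p = j - i"
  have p: "1 \<le> p" "j = i + p"
    using j by (auto simp: p_def)
  have lead_p: "lead (n + p) = lead n" if n: "n1 \<le> n" for n
  proof -
    \<comment> \<open>Levels \<open>m\<close> and \<open>j = i + p\<close> share the pair
      \<open>e\<close>; going down \<open>p\<close> levels shows that \<open>m - p\<close> has the
      pair \<open>e\<close> as well. Going down \<open>d\<close> further levels from
      \<open>m\<close> and \<open>m - p\<close> compares \<open>n + p\<close> with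
      \<open>n\<close>.\<close>
    obtain m where m: "n + p \<le> m" "lead m = e"
      using often by blast
    define d where "d = m - p - n"
    have md: "m = n + d + p"
      using m by (simp add: d_def)
    have "lead (n + d) = lead i"
      by (rule down[of _ p]) (use m md j p i n in auto)
    then have "lead (n + d) = lead (n + p + d)"
      using i m md by (simp add: ac_simps)
    then have "lead n = lead (n + p)"
      by (rule down) (use n in auto)
    then show ?thesis by simp
  qed
  have cs_p: "cs (n + p) = cs n" if n: "n1 \<le> n" for n
    using cut_determined[OF I last, where n = "n + p" and m = n] lead_p[of "Suc n"] n by simp
  have bound: "c + i < w" if "3 * (l + 1) \<le> v" "w = u + v" "i < Suc l + 2" "c < u" for c i l u v w :: nat
    using that by presburger
  \<comment> \<open>Agreement on \<open>l + 2\<close> letters one level up gives one letter more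
    below: the cut removes less than the first block, and the other \<open>l + 1\<close> blocks have
    at least three letters each.\<close>
  have agree: "\<forall>n\<ge>n1. \<forall>i<l + 2. zs (n + p) i = zs n i" for l
  proof (induction l)
    case 0
    show ?case
      using lead_p by (auto simp: lead_def less_Suc_eq numeral_2_eq_2)
  next
    case (Suc l)
    show ?case
    proof (intro allI impI)
      fix n i
      assume n: "n1 \<le> n" and i: "i < Suc l + 2"
      let ?x = "zs (Suc n + p)"
      have x0: "?x 0 = zs (Suc n) 0"
        using lead_p[of "Suc n"] n by (simp add: lead_def)
      have "3 * length (pre (tail 1 ?x) (l + 1)) \<le> length (subst_word \<phi> (pre (tail 1 ?x) (l + 1)))"
        by (rule length_subst_word_ge) (rule length_ge)
      then have "3 * (l + 1) \<le> length (subst_word \<phi> (pre (tail 1 ?x) (l + 1)))"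
        by (simp only: length_map length_upt diff_zero)
      moreover have "pre ?x (l + 2) = ?x 0 # pre (tail 1 ?x) (l + 1)"
        using pre_add[of ?x 1 "l + 1"] by simp
      then have "length (subst_word \<phi> (pre ?x (l + 2)))
          = length (\<phi> (zs (Suc n) 0)) + length (subst_word \<phi> (pre (tail 1 ?x) (l + 1)))"
        using x0 by (simp only: subst_word_Cons length_append)
      ultimately have "cs n + i < length (subst_word \<phi> (pre ?x (l + 2)))"
        using i cs_less[of n] by (metis bound)
      then have "subst_seq \<phi> ?x (cs n + i) = subst_seq \<phi> (zs (Suc n)) (cs n + i)"
        using Suc.IH[rule_format, of "Suc n"] n
        by (intro subst_seq_cong[OF nonerasing, of "l + 2"]) auto
      then show "zs (n + p) i = zs n i"
        using cs_p[OF n] zs_eq[of n] zs_eq[of "n + p"] by simp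
    qed
  qed
  show ?thesis
  proof
    show "1 \<le> p" by (fact p(1))
    show "zs (n + p) = zs n" if "n1 \<le> n" for n
    proof
      fix i
      show "zs (n + p) i = zs n i"
        using agree[of i] that by simp
    qed
  qed
qed

end

section \<open>Self-similarity of tails\<close>

lemma covers_tail_eq:
  assumes "nonerasing \<tau>" "1 \<le> j" "c < length (\<tau> (v 0))"
  shows "\<exists>P. subst_seq \<tau> (tail j v) = tail P (tail c (subst_seq \<tau> v))"
proof -
  have "length (\<tau> (v 0)) \<le> length (subst_word \<tau> (pre v j))"
    using assms(2) pre_add[of v 1 "j - 1"] by simp
  then have "tail (length (subst_word \<tau> (pre v j)) - c) (tail c (subst_seq \<tau> v))
      = tail (length (subst_word \<tau> (pre v j))) (subst_seq \<tau> v)"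
    using assms(3) by simp
  then show ?thesis
    unfolding tail_subst_seq[OF assms(1)] by metis
qed

text \<open>Both \<open>u\<close> and \<open>z\<close> are tails of the image of \<open>u\<close>,
  so one of them is a tail of the other.\<close>

lemma eventually_self_similar:
  assumes "nonerasing \<sigma>" "covers \<sigma> u u" "covers \<sigma> u z"
  shows "\<exists>P M. tail P z = subst_seq \<sigma> (tail M z)"
proof -
  obtain c where c: "c < length (\<sigma> (u 0))" "u = tail c (subst_seq \<sigma> u)"
    using assms(2) by (auto simp: covers_def)
  obtain d where d: "d < length (\<sigma> (u 0))" "z = tail d (subst_seq \<sigma> u)"
    using assms(3) by (auto simp: covers_def)
  show ?thesis
  proof (cases "c \<le> d")
    case True
    then have "z = tail (d - c) u"
      using d(2) by (subst c(2)) simp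
    then show ?thesis
      \<comment> \<open>The summand 1 skips at least the first letter of \<open>u\<close>, whose
        image is cut.\<close>
      using covers_tail_eq[of \<sigma> "d - c + 1" d u] assms(1) d by (metis le_add2 tail_tail)
  next
    case False
    then have "u = tail (c - d) z"
      using c(2) d(2) by simp
    then show ?thesis
      using covers_tail_eq[of \<sigma> 1 d u] assms(1) d by (metis order_refl tail_tail)
  qed
qed

section \<open>The two cases for a tower\<close>

context desubstitution_tower
begin

lemma eventually_self_similar_of_last_pairs:
  assumes I: "\<And>n. n1 \<le> n \<Longrightarrow> lead n \<in> I"
    and last: "\<And>n j. n1 \<le> n \<Longrightarrow> 1 \<le> j \<Longrightarrow> (zs n j, zs n (Suc j)) \<notin> I"
  shows "\<exists>p P M. 1 \<le> p \<and> tail P (zs 0) = subst_seq (subst_pow \<phi> p) (tail M (zs 0))"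
proof -
  obtain p where p: "1 \<le> p" "\<And>n. n1 \<le> n \<Longrightarrow> zs (n + p) = zs n"
    using zs_periodic[OF I last] by metis
  have per: "zs (n + p * i) = zs n" if "n1 \<le> n" for n i
  proof (induction i)
    case (Suc i)
    then show ?case
      using p(2)[of "n + p * i"] that by (simp add: ac_simps)
  qed simp
  \<comment> \<open>A multiple of the period beyond \<open>n1\<close>: level \<open>n + n\<close>
    then equals level \<open>n\<close>, so one power of \<open>\<phi>\<close> leads from level
    \<open>n\<close> both to itself and to level 0.\<close>
  define n where "n = p * Suc n1"
  have "Suc n1 \<le> n"
    using mult_le_mono1[OF p(1), of "Suc n1"] by (simp add: n_def)
  have "zs (n + n) = zs n"
    using per[of n "Suc n1"] \<open>Suc n1 \<le> n\<close> by (simp add: n_def)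
  then have "covers (subst_pow \<phi> n) (zs n) (zs n)"
    using zs_covers[of n n] by simp
  moreover have "covers (subst_pow \<phi> n) (zs n) (zs 0)"
    using zs_covers[of n 0] by simp
  ultimately obtain P M where "tail P (zs 0) = subst_seq (subst_pow \<phi> n) (tail M (zs 0))"
    using eventually_self_similar[OF nonerasing_pow[OF nonerasing]] by blast
  then show ?thesis
    using \<open>Suc n1 \<le> n\<close> by (intro exI[of _ n] exI[of _ P] exI[of _ M]) auto
qed

text \<open>By \<open>rep\<close>, already \<open>\<phi>\<close> reproduces \<open>ab\<close>, so
  occurrences of \<open>ab\<close> away from the start persist at all lower levels. The sequence
  \<open>z\<close> is built to contain such an occurrence too. Prefixes of \<open>z\<close> and of
  \<open>zs 0\<close> lie in images of \<open>ab\<close>, and the uncut occurrences carry these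
  images into the other sequence.\<close>

lemma recurrent_pair_limit:
  assumes lead: "infinite {n. lead n = (a, b)}"
    and occ: "infinite {n. \<exists>j\<ge>1. zs n j = a \<and> zs n (Suc j) = b}"
    and rep: "\<And>m. 1 \<le> m \<Longrightarrow> reproduces (subst_pow \<phi> m) a b \<Longrightarrow> reproduces \<phi> a b"
  shows "\<exists>z p. 1 \<le> p \<and> covers (subst_pow \<phi> p) z z \<and> limit_of (zs 0) z \<and> limit_of z (zs 0)"
proof -
  have often: "\<exists>n\<ge>l. lead n = (a, b)" for l
    using lead unfolding infinite_nat_iff_unbounded_le by blast
  have growth: "n < length (subst_pow \<phi> n c)" for n c
  proof -
    have "n < 3 ^ n" by (induction n) auto
    then show ?thesis
      using length_subst_pow_ge[of 3 \<phi> n c] length_ge by (meson less_le_trans)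
  qed
  obtain n where n: "lead n = (a, b)"
    using often by blast
  have "reproduces \<phi> a b"
  proof -
    obtain n' where n': "n' \<ge> Suc n" "lead n' = (a, b)"
      using often by blast
    have "reproduces (subst_pow \<phi> (n' - n)) a b"
      using covers_reproduces[OF nonerasing_pow[OF nonerasing] zs_covers[of "n' - n" n]] n n'
      by (simp add: lead_def)
    then show ?thesis
      using rep[of "n' - n"] n'(1) by (simp add: Suc_le_eq)
  qed
  then obtain s t where st: "subst_word \<phi> [a, b] = s @ [a, b] @ t"
    by (auto simp: reproduces_def)
  have step: "\<exists>j\<ge>1. zs n j = a \<and> zs n (Suc j) = b"
    if ex: "\<exists>j\<ge>1. zs (Suc n) j = a \<and> zs (Suc n) (Suc j) = b" for n
  proof -
    obtain j where j: "j \<ge> 1" "zs (Suc n) j = a" "zs (Suc n) (Suc j) = b"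
      using ex by blast
    have "covers \<phi> (zs (Suc n)) (zs n)"
      using zs_covers[of 1 n] by simp
    then obtain m where m: "m \<ge> 1"
        "\<And>i. i < length (subst_word \<phi> [a, b]) \<Longrightarrow> zs n (m + i) = subst_word \<phi> [a, b] ! i"
      using covers_occurrence[OF nonerasing _ j] by blast
    show ?thesis
      using m(1) m(2)[of "length s"] m(2)[of "Suc (length s)"] unfolding st
      by (intro exI[of _ "m + length s"]) (auto simp: nth_append)
  qed
  have down: "\<exists>j\<ge>1. zs n j = a \<and> zs n (Suc j) = b"
    if "n \<le> m" "\<exists>j\<ge>1. zs m j = a \<and> zs m (Suc j) = b" for n m
    using that(1) by (induction n rule: inc_induct) (use that(2) step in blast)+
  have occ: "\<exists>j\<ge>1. zs n j = a \<and> zs n (Suc j) = b" for n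
  proof -
    obtain m where "n \<le> m" "\<exists>j\<ge>1. zs m j = a \<and> zs m (Suc j) = b"
      using occ unfolding infinite_nat_iff_unbounded_le by blast
    then show ?thesis
      by (rule down)
  qed
  obtain j where j: "j \<ge> 1" "zs n j = a" "zs n (Suc j) = b"
    using occ by blast
  \<comment> \<open>The gap \<open>p\<close> exceeds \<open>j\<close>, so the prefix of
    \<open>zs n\<close> through its occurrence of \<open>ab\<close> at \<open>j\<close> fits into
    the image of the pair leading level \<open>n'\<close>.\<close>
  obtain n' where n': "n' \<ge> n + Suc j" "lead n' = (a, b)"
    using often by blast
  define p where "p = n' - n"
  define \<tau> where "\<tau> = subst_pow \<phi> p"
  have p: "Suc j \<le> p" "n' = n + p"
    using n'(1) by (auto simp: p_def)
  have ne: "nonerasing \<tau>"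
    unfolding \<tau>_def by (rule nonerasing_pow[OF nonerasing])
  have "j + 2 \<le> Suc (length (\<tau> (zs n' 1)))"
    using growth[of p "zs n' 1"] p(1) by (simp add: \<tau>_def)
  then obtain s t where st: "subst_word \<tau> [a, b] = s @ pre (zs n) (j + 2) @ t" "length s < length (\<tau> a)"
    using covers_prefix[OF ne, of "zs n'" "zs n" "j + 2"] zs_covers[of p n] n'(2) p(2)
    by (auto simp: \<tau>_def lead_def)
  have "pre (zs n) (j + 2) = [a, b] @ pre (tail 2 (zs n)) j"
    using pre_add[of "zs n" 2 j] n by (simp add: lead_def numeral_2_eq_2)
  then have "subst_word \<tau> [a, b] = s @ [a, b] @ (pre (tail 2 (zs n)) j @ t)"
    using st(1) by simp
  moreover have "2 \<le> length (\<tau> c)" for c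
    using growth[of p c] p(1) j(1) by (simp add: \<tau>_def)
  ultimately obtain z where z: "z = tail (length s) (subst_seq \<tau> z)" "z 0 = a" "z 1 = b"
    using exists_self_covering st(2) by metis
  have cov: "covers \<tau> z z"
    using z st(2) unfolding covers_def by blast
  have z2: "pre z 2 = [a, b]"
    using z(2,3) by (simp add: numeral_2_eq_2)
  \<comment> \<open>Thus \<open>z\<close> contains \<open>ab\<close> at \<open>j \<ge> 1\<close> as
    well, where no cut interferes.\<close>
  have zj: "z i = zs n i" if "i < j + 2" for i
  proof -
    have "z i = subst_seq \<tau> z (length s + i)"
      by (subst z(1)) simp
    also have "\<dots> = subst_word \<tau> (pre z 2) ! (length s + i)"
      using that st(1) by (intro subst_seq_nth[OF ne]) (simp only: z2, simp)
    also have "\<dots> = zs n i"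
      unfolding z2 st(1) using that by (simp add: nth_append del: upt_Suc)
    finally show ?thesis .
  qed
  have "limit_of (zs 0) z"
  proof (rule limit_ofI)
    fix l
    obtain N where N: "N \<ge> l" "lead N = (a, b)"
      using often by blast
    obtain s1 t1 where 1: "subst_word (subst_pow \<phi> N) [a, b] = s1 @ pre (zs 0) l @ t1"
      using covers_prefix[OF nonerasing_pow[OF nonerasing] zs_covers[of N 0], of l] growth[of N b] N
      by (auto simp: lead_def)
    \<comment> \<open>Images of \<open>ab\<close> under powers of \<open>\<tau>\<close> are the ones
      available in \<open>z\<close>, so the exponent is raised to a multiple of
      \<open>p\<close>.\<close>
    have "N \<le> p * N"
      using p(1) by (cases p) auto
    then obtain s2 t2 where "subst_word (subst_pow \<phi> (p * N)) [a, b]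
        = s2 @ subst_word (subst_pow \<phi> N) [a, b] @ t2"
      using reproduces_factor[OF \<open>reproduces \<phi> a b\<close>] by blast
    then have "subst_word (subst_pow \<tau> N) [a, b] = (s2 @ s1) @ pre (zs 0) l @ (t1 @ t2)"
      using 1 by (simp add: \<tau>_def subst_pow_mult)
    moreover have "factor (subst_word (subst_pow \<tau> N) [a, b]) z"
      by (rule covers_factor[OF nonerasing_pow[OF ne] covers_pow_self[OF ne cov] j(1)])
        (use zj[of j] zj[of "Suc j"] j in auto)
    ultimately show "factor (pre (zs 0) l) z"
      using factor_sublist by metis
  qed
  moreover have "limit_of z (zs 0)"
  proof (rule limit_ofI)
    fix l
    have "l \<le> Suc (length (subst_pow \<tau> l b))"
    proof -
      have "l < 2 ^ l" by (rule less_exp)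
      also have "\<dots> \<le> length (subst_pow \<tau> l b)"
        by (rule length_subst_pow_ge) fact
      finally show ?thesis by simp
    qed
    then obtain s1 t1 where 1: "subst_word (subst_pow \<tau> l) [a, b] = s1 @ pre z l @ t1"
      using covers_prefix[OF nonerasing_pow[OF ne] covers_pow_self[OF ne cov], of l l] z(2,3) by auto
    obtain i where i: "i \<ge> 1" "zs (p * l) i = a" "zs (p * l) (Suc i) = b"
      using occ by blast
    have "factor (subst_word (subst_pow \<phi> (p * l)) [a, b]) (zs 0)"
      using covers_factor[OF nonerasing_pow[OF nonerasing] _ i] zs_covers[of "p * l" 0] by simp
    then show "factor (pre z l) (zs 0)"
      using 1 factor_sublist by (metis \<tau>_def subst_pow_mult)
  qed
  ultimately show ?thesis
    using cov p(1) by (intro exI[of _ z] exI[of _ p]) (auto simp: \<tau>_def)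
qed

end

text \<open>Only when a pair from \<open>I\<close> recurs away from the start is a new
  \<open>y\<close> constructed; otherwise \<open>y\<close> is \<open>z\<close> itself.\<close>

lemma exists_eventually_self_similar:
  fixes \<phi> :: "'a \<Rightarrow> 'a list"
  assumes A: "finite A" and x: "x \<in> UNIV \<rightarrow> A" and len: "\<And>a. 3 \<le> length (\<phi> a)"
    and fixed: "subst_seq \<phi> x = x" and z: "limit_of z x"
    and rep: "\<And>a b m. a \<in> A \<Longrightarrow> b \<in> A \<Longrightarrow> 1 \<le> m \<Longrightarrow> reproduces (subst_pow \<phi> m) a b
      \<Longrightarrow> reproduces \<phi> a b"
  shows "\<exists>y p P M. limit_of z y \<and> limit_of y z \<and> 1 \<le> p \<and>
    tail P y = subst_seq (subst_pow \<phi> p) (tail M y)"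
proof -
  have ne: "nonerasing \<phi>"
    using nonerasingI[of 3 \<phi>] len by simp
  have "\<exists>zs. \<forall>n. (limit_of (zs n) x \<and> (n = 0 \<longrightarrow> zs n = z)) \<and> covers \<phi> (zs (Suc n)) (zs n)"
    by (rule dependent_nat_choice) (use z limit_of_desubstitute[OF A x ne fixed] in auto)
  then obtain zs where zs: "\<And>n. limit_of (zs n) x" "zs 0 = z" "\<And>n. covers \<phi> (zs (Suc n)) (zs n)"
    by blast
  obtain cs where cs: "\<And>n. cs n < length (\<phi> (zs (Suc n) 0))"
      "\<And>n. zs n = tail (cs n) (subst_seq \<phi> (zs (Suc n)))"
    using zs(3) unfolding covers_def by metis
  have zsA: "zs n i \<in> A" for n i
    using limit_of_in[OF zs(1) x] by auto
  interpret desubstitution_tower \<phi> A zs cs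
    by unfold_locales (fact len A zsA cs)+
  define I where "I = {e. infinite {n. lead n = e}}"
  define occ where "occ e = {n. \<exists>j\<ge>1. (zs n j, zs n (Suc j)) = e}" for e
  have leadA: "lead n \<in> A \<times> A" for n
    by (auto simp: lead_def zsA)
  show ?thesis
  proof (cases "\<exists>e\<in>I. infinite (occ e)")
    case True
    then obtain a b where ab: "(a, b) \<in> I" "infinite (occ (a, b))"
      by auto
    have "a \<in> A" "b \<in> A"
    proof -
      obtain n where "lead n = (a, b)"
        using ab(1) not_finite_existsD by (auto simp: I_def)
      then show "a \<in> A" "b \<in> A"
        using leadA[of n] by auto
    qed
    then obtain y p where y: "1 \<le> p" "covers (subst_pow \<phi> p) y y" "limit_of z y" "limit_of y z"
      using recurrent_pair_limit[of a b] ab rep[of a b] zs(2) by (auto simp: I_def occ_def)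
    then obtain P M where "tail P y = subst_seq (subst_pow \<phi> p) (tail M y)"
      using eventually_self_similar[OF nonerasing_pow[OF ne]] by blast
    then show ?thesis
      using y by blast
  next
    case False
    \<comment> \<open>The exceptional levels: a pair from \<open>I\<close> occurs away from the
      start, or the leading pair lies outside \<open>I\<close>. In this case each pair contributes
      finitely many.\<close>
    define F where "F = (\<Union>e\<in>A \<times> A. if e \<in> I then occ e else {n. lead n = e})"
    have "finite F"
      unfolding F_def using A False by (intro finite_UN_I) (auto simp: I_def)
    then obtain n1 where n1: "\<And>n. n \<in> F \<Longrightarrow> n < n1"
      by (auto simp: finite_nat_set_iff_bounded)
    have I: "lead n \<in> I" if "n1 \<le> n" for n
    proof (rule ccontr)
      assume "lead n \<notin> I"
      then have "n \<in> F"
        unfolding F_def using leadA[of n] by (intro UN_I[of "lead n"]) auto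
      then show False
        using n1 that by fastforce
    qed
    have last: "(zs n j, zs n (Suc j)) \<notin> I" if "n1 \<le> n" "1 \<le> j" for n j
    proof
      assume "(zs n j, zs n (Suc j)) \<in> I"
      then have "n \<in> F"
        unfolding F_def using zsA that(2)
        by (intro UN_I[of "(zs n j, zs n (Suc j))"]) (auto simp: occ_def)
      then show False
        using n1 that by fastforce
    qed
    obtain p P M where "1 \<le> p" "tail P z = subst_seq (subst_pow \<phi> p) (tail M z)"
      using eventually_self_similar_of_last_pairs[OF I last] zs(2) by blast
    moreover have "limit_of z z"
      unfolding limit_of_def by (metis add_0)
    ultimately show ?thesis by blast
  qed
qed

section \<open>Eventually self-similar sequences are substitutive or automatic\<close>

lemma substitution_of_length_ge_2:
  assumes "\<And>a. 2 \<le> length (\<phi> a)" "\<And>a. a \<in> A \<Longrightarrow> set (\<phi> a) \<subseteq> A"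
  shows "substitution A \<phi>"
proof -
  have "filterlim (\<lambda>n. length ((subst_word \<phi> ^^ n) [a])) at_top sequentially" for a
  proof (rule filterlim_at_top_mono[OF filterlim_ident])
    have "n \<le> length ((subst_word \<phi> ^^ n) [a])" for n
    proof -
      have "n < 2 ^ n" by (rule less_exp)
      also have "\<dots> \<le> length (subst_pow \<phi> n a)"
        by (rule length_subst_pow_ge) (rule assms(1))
      finally show ?thesis by (simp add: subst_pow_def)
    qed
    then show "\<forall>\<^sub>F n in sequentially. n \<le> length ((subst_word \<phi> ^^ n) [a])"
      by simp
  qed
  then show ?thesis
    using assms(2) by (auto simp: substitution_def)
qed

text \<open>The marked sequence is fixed by a substitution that follows \<open>\<tau>\<close> beyond
  a finite beginning and is tailored to the positions before; forgetting the marks is the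
  coding.\<close>

lemma substitutive_of_eventually_self_similar:
  fixes z :: "nat \<Rightarrow> 'a"
  assumes A: "finite A" and z: "z \<in> UNIV \<rightarrow> A" and len: "\<And>a. 3 \<le> length (\<tau> a)"
    and \<tau>A: "\<And>a. set (\<tau> a) \<subseteq> A" and self: "tail P z = subst_seq \<tau> (tail M z)"
  shows "substitutive A z"
proof -
  have ne: "nonerasing \<tau>"
    using nonerasingI[of 3 \<tau>] len by simp
  \<comment> \<open>Moving on by \<open>2 * M + 1\<close> letters moves the image by at least
    \<open>3 * (2 * M + 1)\<close>, which is at least twice the new
    \<open>N = M + (2 * M + 1)\<close>. This leaves room for blocks of two letters at the first
    \<open>N\<close> positions.\<close>
  obtain Q N where Q: "tail Q z = subst_seq \<tau> (tail N z)" "2 * N \<le> Q" "1 \<le> N"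
  proof
    let ?w = "subst_word \<tau> (pre (tail M z) (2 * M + 1))"
    have "3 * length (pre (tail M z) (2 * M + 1)) \<le> length ?w"
      by (rule length_subst_word_ge) (rule len)
    then have "3 * (2 * M + 1) \<le> length ?w"
      by (simp only: length_map length_upt diff_zero)
    moreover have "2 * (M + (2 * M + 1)) \<le> 3 * (2 * M + 1)"
      by simp
    ultimately have "2 * (M + (2 * M + 1)) \<le> length ?w"
      by (rule order_trans[rotated])
    then show "2 * (M + (2 * M + 1)) \<le> P + length ?w"
      by (rule trans_le_add2)
    have "tail (P + length ?w) z = tail (length ?w) (tail P z)"
      by simp
    also have "\<dots> = subst_seq \<tau> (tail (M + (2 * M + 1)) z)"
      unfolding self by (simp only: tail_subst_seq[OF ne] tail_tail)
    finally show "tail (P + length ?w) z = subst_seq \<tau> (tail (M + (2 * M + 1)) z)" .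
  qed simp
  \<comment> \<open>The first \<open>N\<close> positions carry their own index, so that their blocks, which tile
    \<open>{0..<Q}\<close>, can be chosen freely.\<close>
  define U where "U n = (min n N, z n)" for n
  define \<psi> where "\<psi> e = (if Suc (fst e) < N then map U [2 * fst e..<2 * fst e + 2]
      else if Suc (fst e) = N then map U [2 * fst e..<Q] else map (Pair N) (\<tau> (snd e)))" for e
  \<comment> \<open>The block at position \<open>N - 1\<close> takes everything from
    \<open>2 * (N - 1)\<close> up to \<open>Q\<close>, at least two letters because
    \<open>2 * N \<le> Q\<close>.\<close>
  have len\<psi>: "2 \<le> length (\<psi> e)" for e
    using Q(2,3) len[of "snd e"] by (auto simp: \<psi>_def)
  have ne\<psi>: "nonerasing \<psi>"
    using nonerasingI[of 2 \<psi>] len\<psi> by simp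
  have upt_split: "map U [i..<j] @ map U [j..<l] = map U [i..<l]" if "i \<le> j" "j \<le> l" for i j l
    using that upt_add_eq_append[of i j "l - j"] by simp
  have \<psi>U: "\<psi> (U m) = map U [2 * m..<2 * m + 2]" if "Suc m < N" for m
    using that by (simp add: \<psi>_def U_def)
  have \<psi>U': "\<psi> (U m) = map U [2 * m..<Q]" if "Suc m = N" for m
    using that by (simp add: \<psi>_def U_def)
  have small: "subst_word \<psi> (pre U m) = pre U (2 * m)" if "m < N" for m
    using that
  proof (induction m)
    case (Suc m)
    have "subst_word \<psi> (pre U (Suc m)) = pre U (2 * m) @ map U [2 * m..<2 * m + 2]"
      using Suc \<psi>U[of m] by simp
    also have "\<dots> = pre U (2 * Suc m)"
      using upt_split[of 0 "2 * m" "2 * m + 2"] by simp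
    finally show ?case .
  qed simp
  have mid: "subst_word \<psi> (pre U N) = pre U Q"
  proof -
    obtain m where m: "N = Suc m"
      using Q(3) by (cases N) auto
    have "subst_word \<psi> (pre U N) = pre U (2 * m) @ map U [2 * m..<Q]"
      using small[of m] \<psi>U'[of m] by (simp add: m)
    then show ?thesis
      using upt_split[of 0 "2 * m" Q] Q(2) by (simp add: m)
  qed
  have tail_part: "subst_word \<psi> (pre (tail N U) j) = map (Pair N) (subst_word \<tau> (pre (tail N z) j))" for j
    by (induction j) (auto simp: \<psi>_def U_def)
  have "\<exists>l. subst_word \<psi> (pre U m) = pre U l" for m
  proof (cases "m < N")
    case True
    then show ?thesis using small by blast
  next
    case False
    define j where "j = m - N"
    define l where "l = length (subst_word \<tau> (pre (tail N z) j))"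
    have m: "m = N + j"
      using False by (simp add: j_def)
    have "subst_word \<psi> (pre (tail N U) j) = map (Pair N) (pre (subst_seq \<tau> (tail N z)) l)"
      unfolding tail_part l_def pre_subst_seq[OF ne] ..
    also have "\<dots> = pre (tail Q U) l"
      using Q(2) unfolding Q(1)[symmetric] by (auto simp: U_def)
    finally have "subst_word \<psi> (pre U m) = pre U (Q + l)"
      unfolding m pre_add by (simp only: subst_word_append mid)
    then show ?thesis by blast
  qed
  then have fixed: "subst_seq \<psi> U = U"
    by (intro subst_seq_eqI[OF ne\<psi>]) (metis add_0 diff_zero length_map length_upt nth_map_upt)
  have UB: "U n \<in> {..N} \<times> A" for n
    using z by (auto simp: U_def)
  have "substitution ({..N} \<times> A) \<psi>"
  proof (rule substitution_of_length_ge_2[OF len\<psi>])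
    have "set (map U w) \<subseteq> {..N} \<times> A" for w
      unfolding set_map using UB by blast
    moreover have "set (map (Pair N) (\<tau> a)) \<subseteq> {..N} \<times> A" for a
      using \<tau>A by auto
    ultimately show "set (\<psi> e) \<subseteq> {..N} \<times> A" for e
      unfolding \<psi>_def by presburger
  qed
  moreover have "alphabet ({..N} \<times> A)"
    using A UB[of 0] by (auto simp: alphabet_def)
  moreover have "U \<in> UNIV \<rightarrow> {..N} \<times> A"
    using UB by blast
  ultimately have "purely_substitutive ({..N} \<times> A) U"
    unfolding purely_substitutive_def using fixed by blast
  then have "substitutive A (snd \<circ> U)"
    by (rule substitutiveI) auto
  then show ?thesis
    by (simp add: U_def comp_def)
qed

section \<open>Automaticity from determined blocks\<close>

lemma purely_automatic_of_determined:
  assumes k: "2 \<le> k" and fin: "finite (range U)"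
    and det: "\<And>n n' r. U n = U n' \<Longrightarrow> r < k \<Longrightarrow> U (k * n + r) = U (k * n' + r)"
  shows "purely_automatic k (range U) U"
proof -
  \<comment> \<open>By \<open>det\<close> any position carrying \<open>b\<close> yields the same
    block. For \<open>b\<close> outside the range the choice is arbitrary, but the block still has
    \<open>k\<close> letters from the range.\<close>
  define \<phi> where "\<phi> b = map (\<lambda>r. U (k * (SOME n. U n = b) + r)) [0..<k]" for b
  have \<phi>U: "\<phi> (U n) = map (\<lambda>r. U (k * n + r)) [0..<k]" for n
  proof -
    have "U (SOME m. U m = U n) = U n"
      by (rule someI) (rule refl)
    then have "U (k * (SOME m. U m = U n) + r) = U (k * n + r)" if "r < k" for r
      using det that by blast
    then show ?thesis
      unfolding \<phi>_def by (intro map_cong) auto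
  qed
  have len: "length (\<phi> b) = k" for b
    by (simp add: \<phi>_def)
  have "subst_word \<phi> (pre U m) = pre U (k * m)" for m
  proof (induction m)
    case (Suc m)
    have "pre U (k * m + k) = pre U (k * m) @ \<phi> (U m)"
      unfolding pre_add \<phi>U by simp
    then show ?case
      using Suc by (simp add: ac_simps)
  qed simp
  then have "subst_seq \<phi> U = U"
    using k by (intro subst_seq_eqI nonerasingI[of k]) (auto simp: len)
  moreover have "substitution (range U) \<phi>"
    using k by (intro substitution_of_length_ge_2) (auto simp: len, auto simp: \<phi>_def)
  ultimately show ?thesis
    using k fin len by (auto simp: purely_automatic_def alphabet_def constant_length_def)
qed

text \<open>The classical passage from base \<open>k ^ p\<close> to base \<open>k\<close>. For each
  \<open>s < p\<close>, \<open>V n\<close> stores the block of \<open>k ^ s\<close> letters of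
  \<open>U\<close> starting at \<open>k ^ s * n\<close>. The block for \<open>s\<close> at
  \<open>k * n + r\<close> lies in the one for \<open>s + 1\<close> at \<open>n\<close>, which is
  stored or, if \<open>s + 1 = p\<close>, computed from \<open>U n\<close> by
  \<open>det\<close>.\<close>

lemma automatic_of_determined_power:
  assumes k: "2 \<le> k" "1 \<le> p" and fin: "finite (range U)"
    and det: "\<And>n n' r. U n = U n' \<Longrightarrow> r < k ^ p \<Longrightarrow> U (k ^ p * n + r) = U (k ^ p * n' + r)"
    and \<pi>: "\<And>n. \<pi> (U n) \<in> A"
  shows "automatic k A (\<pi> \<circ> U)"
proof -
  define V where "V n = map (\<lambda>s. map (\<lambda>i. U (k ^ s * n + i)) [0..<k ^ s]) [0..<p]" for n
  have V_eq: "V n = V n' \<longleftrightarrow> (\<forall>s<p. \<forall>i<k ^ s. U (k ^ s * n + i) = U (k ^ s * n' + i))" for n n'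
    by (auto simp: V_def)
  have V0: "hd (hd (V n)) = U n" for n
    using k by (simp add: V_def hd_map)
  have det': "V (k * n + r) = V (k * n' + r)" if VV: "V n = V n'" and r: "r < k" for n n' r
    unfolding V_eq
  proof (intro allI impI)
    fix s i
    assume s: "s < p" and i: "i < k ^ s"
    have split: "k ^ s * (k * m + r) + i = k ^ Suc s * m + (k ^ s * r + i)" for m
      by (simp add: algebra_simps)
    have "k ^ s * r + i < k ^ s * Suc r"
      using i by simp
    also have "\<dots> \<le> k ^ s * k"
      using r by (intro mult_le_mono2) simp
    finally have less: "k ^ s * r + i < k ^ Suc s"
      by (simp add: ac_simps)
    show "U (k ^ s * (k * n + r) + i) = U (k ^ s * (k * n' + r) + i)"
    proof (cases "Suc s < p")
      case True
      then show ?thesis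
        using VV less unfolding V_eq split by blast
    next
      case False
      then have "p = Suc s"
        using s by simp
      moreover have "U n = U n'"
        using V0[of n] V0[of n'] VV by simp
      ultimately show ?thesis
        using det less unfolding split by blast
    qed
  qed
  have "finite (range V)"
  proof (rule finite_subset)
    let ?W = "{w. set w \<subseteq> range U \<and> length w \<le> k ^ p}"
    show "range V \<subseteq> {v. set v \<subseteq> ?W \<and> length v = p}"
      using k by (auto simp: V_def intro: power_increasing)
    show "finite {v. set v \<subseteq> ?W \<and> length v = p}"
      by (intro finite_lists_length_eq finite_lists_length_le fin)
  qed
  then have "purely_automatic k (range V) V"
    using k(1) det' by (intro purely_automatic_of_determined)
  moreover have "(\<lambda>v. \<pi> (hd (hd v))) \<in> range V \<rightarrow> A"
    using \<pi> by (auto simp: V0)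
  ultimately have "automatic k A ((\<lambda>v. \<pi> (hd (hd v))) \<circ> V)"
    by (rule automaticI)
  then show ?thesis
    by (simp add: comp_def V0)
qed

text \<open>Scaling by \<open>K\<close> dominates the fixed displacements \<open>P\<close> and
  \<open>M\<close>, so a wide window around \<open>n\<close> determines the window of the same width
  around \<open>K * n + r\<close>.\<close>

lemma automatic_of_eventually_self_similar:
  fixes z :: "nat \<Rightarrow> 'a"
  assumes k: "2 \<le> k" "1 \<le> p" and A: "finite A" and z: "z \<in> UNIV \<rightarrow> A"
    and len: "\<And>a. length (\<tau> a) = k ^ p" and self: "tail P z = subst_seq \<tau> (tail M z)"
  shows "automatic k A z"
proof -
  define K where "K = k ^ p"
  have K: "2 \<le> K"
    using k power_increasing[of 1 p k] by (simp add: K_def)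
  have ne: "nonerasing \<tau>"
    by (rule nonerasingI[of K]) (use len K k(1) in \<open>auto simp: K_def\<close>)
  have z_rec: "z (P + K * n + r) = \<tau> (z (M + n)) ! r" if "r < K" for n r
  proof -
    have l: "length (subst_word \<tau> (pre (tail M z) n)) = K * n"
      using length_subst_word_const[of \<tau> K "pre (tail M z) n"] len by (simp add: K_def)
    have "z (P + K * n + r) = tail P z (K * n + r)"
      by (simp add: add.assoc)
    also have "\<dots> = subst_seq \<tau> (tail M z) (K * n + r)"
      by (simp only: self)
    also have "\<dots> = subst_word \<tau> (pre (tail M z) (Suc n)) ! (K * n + r)"
      using that l len by (intro subst_seq_nth[OF ne]) (simp add: K_def)
    also have "\<dots> = \<tau> (z (M + n)) ! r"
      using l by (simp add: nth_append)
    finally show ?thesis .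
  qed
  \<comment> \<open>Large enough that \<open>K * D\<close> exceeds \<open>D + P\<close> and that
    every window index needed below is at most \<open>2 * D\<close>.\<close>
  define D where "D = 2 * M + P + 2"
  \<comment> \<open>The entry \<open>min n D\<close> identifies each position below
    \<open>D\<close>; from \<open>D\<close> on, the subtraction in \<open>n + j - D\<close> is never
    truncated.\<close>
  define U where "U n = (min n D, map (\<lambda>j. z (n + j - D)) [0..<2 * D + 1])" for n
  have window: "z (n + j - D) = z (n' + j - D)" if "U n = U n'" "j \<le> 2 * D" for n n' j
    using that by (auto simp: U_def simp del: upt_Suc)
  have det: "U (K * n + r) = U (K * n' + r)" if UU: "U n = U n'" and r: "r < K" for n n' r
  proof (cases "n < D")
    case True
    then have "n = n'"
      using UU by (auto simp: U_def min_def split: if_splits)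
    then show ?thesis by simp
  next
    case False
    then have D: "D \<le> n" "D \<le> n'"
      using UU by (auto simp: U_def min_def split: if_splits)
    have KD: "2 * D \<le> K * D"
      using K by (rule mult_le_mono1)
    \<comment> \<open>The position is \<open>P + K * (m - D) + t\<close> with \<open>t\<close>
      independent of \<open>m\<close>; division of \<open>t\<close> by \<open>K\<close> gives a
      source at a fixed distance from \<open>m\<close>.\<close>
    have rec: "z (K * m + r + j - D) = \<tau> (z (m + (M + (K * D + r + j - D - P) div K) - D))
        ! ((K * D + r + j - D - P) mod K)" if "D \<le> m" for m j
    proof -
      let ?t = "K * D + r + j - D - P"
      have "K * m = K * (m - D) + K * D"
        using that by (simp flip: distrib_left)
      then have "K * m + r + j - D = P + K * (m - D) + ?t"
        using KD by (simp add: D_def)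
      also have "\<dots> = P + K * (m - D + ?t div K) + ?t mod K"
        by (simp add: distrib_left)
      finally have "z (K * m + r + j - D) = \<tau> (z (M + (m - D + ?t div K))) ! (?t mod K)"
        using z_rec[of "?t mod K" "m - D + ?t div K"] K by simp
      moreover have "M + (m - D + ?t div K) = m + (M + ?t div K) - D"
        using that by simp
      ultimately show ?thesis by simp
    qed
    have "z (K * n + r + j - D) = z (K * n' + r + j - D)" if j: "j < 2 * D + 1" for j
    proof -
      let ?t = "K * D + r + j - D - P"
      have "2 * (D - M) \<le> K * (D - M)"
        using K by (rule mult_le_mono1)
      then have "?t < K * D + K * (D - M) + K"
        using r j by (simp add: D_def)
      also have "\<dots> = K * (D + (D - M) + 1)"
        by (simp add: algebra_simps)
      finally have "?t div K < D + (D - M) + 1"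
        using K by (simp add: div_less_iff_less_mult mult.commute)
      then have "M + ?t div K \<le> 2 * D"
        by (simp add: D_def)
      then show ?thesis
        unfolding rec[OF D(1)] rec[OF D(2)] using window[OF UU] by simp
    qed
    moreover have "D \<le> K * n + r" "D \<le> K * n' + r"
      using D mult_le_mono1[OF K, of n] mult_le_mono1[OF K, of n'] by linarith+
    ultimately show ?thesis
      by (simp add: U_def del: upt_Suc)
  qed
  have fin: "finite (range U)"
  proof (rule finite_subset)
    show "range U \<subseteq> {..D} \<times> {w. set w \<subseteq> A \<and> length w = 2 * D + 1}"
      using z by (auto simp: U_def Pi_iff simp del: upt_Suc)
    show "finite ({..D} \<times> {w. set w \<subseteq> A \<and> length w = 2 * D + 1})"
      using A by (intro finite_cartesian_product finite_lists_length_eq) auto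
  qed
  have centre: "snd (U n) ! D = z n" for n
    by (simp add: U_def nth_append del: upt_Suc)
  have "automatic k A ((\<lambda>u. snd u ! D) \<circ> U)"
  proof (rule automatic_of_determined_power[OF k fin])
    show "U (k ^ p * n + r) = U (k ^ p * n' + r)" if "U n = U n'" "r < k ^ p" for n n' r
      using det[of n n' r] that unfolding K_def by blast
    show "snd (U n) ! D \<in> A" for n
      unfolding centre using z by blast
  qed
  then show ?thesis
    by (simp add: comp_def centre)
qed

section \<open>Transitive subsystems\<close>

text \<open>Letters outside \<open>B\<close> are treated like one fixed letter of \<open>B\<close>,
  so constant length is inherited. Finiteness of \<open>B\<close> makes the growth uniform.\<close>

lemma total_extension:
  fixes \<phi> :: "'a \<Rightarrow> 'a list"
  assumes B: "alphabet B" and x: "x \<in> UNIV \<rightarrow> B" and \<phi>: "substitution B \<phi>" "subst_seq \<phi> x = x"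
  obtains \<psi> r where "\<And>a. set (\<psi> a) \<subseteq> B" "\<And>a. \<psi> a \<in> \<phi> ` B" "subst_seq \<psi> x = x" "nonerasing \<psi>"
    "1 \<le> r" "\<And>a. 3 \<le> length (subst_pow \<psi> r a)"
proof -
  obtain b where b: "b \<in> B"
    using B by (auto simp: alphabet_def)
  define \<psi> where "\<psi> a = \<phi> (if a \<in> B then a else b)" for a
  have \<psi>B: "set (\<psi> a) \<subseteq> B" for a
    using \<phi>(1) b by (auto simp: \<psi>_def substitution_def)
  have word: "subst_word \<psi> w = subst_word \<phi> w" if "set w \<subseteq> B" for w
    using that by (induction w) (auto simp: \<psi>_def)
  have pow: "(subst_word \<psi> ^^ n) [a] = (subst_word \<phi> ^^ n) [a] \<and> set ((subst_word \<psi> ^^ n) [a]) \<subseteq> B"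
    if "a \<in> B" for a n
  proof (induction n)
    case (Suc n)
    then show ?case
      using word set_subst_word[of \<psi> B, OF \<psi>B] by (metis comp_apply funpow.simps(2))
  qed (simp add: that)
  have "set (pre x m) \<subseteq> B" for m
    using x by auto
  then have fixed: "subst_seq \<psi> x = x"
    using \<phi>(2) by (simp add: subst_seq_def word fun_eq_iff)
  have "\<forall>\<^sub>F n in sequentially. \<forall>a\<in>B. 3 \<le> length ((subst_word \<phi> ^^ n) [a])"
    using B \<phi>(1) by (intro eventually_ball_finite) (auto simp: alphabet_def substitution_def filterlim_at_top)
  \<comment> \<open>The exponent is a successor because one application already turns every letter
    into a word over \<open>B\<close>.\<close>
  then obtain r where r: "\<And>a. a \<in> B \<Longrightarrow> 3 \<le> length ((subst_word \<phi> ^^ Suc r) [a])"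
    unfolding eventually_sequentially by (meson le_SucI order_refl)
  have long: "3 \<le> length (subst_pow \<psi> (Suc r) a)" for a
  proof -
    let ?a = "if a \<in> B then a else b"
    have "subst_pow \<psi> (Suc r) a = subst_pow \<psi> (Suc r) ?a"
      using b by (simp add: subst_pow_def funpow_swap1) (simp add: \<psi>_def)
    also have "\<dots> = (subst_word \<phi> ^^ Suc r) [?a]"
      unfolding subst_pow_def using pow[of ?a "Suc r"] b by simp
    finally show ?thesis
      using r[of ?a] b by simp
  qed
  have "nonerasing \<psi>"
    unfolding nonerasing_def
  proof (intro allI notI)
    fix a
    assume "\<psi> a = []"
    then have "subst_pow \<psi> (Suc r) a = (subst_word \<psi> ^^ r) []"
      by (simp add: subst_pow_def funpow_swap1)
    also have "\<dots> = []"
      by (induction r) auto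
    finally show False
      using long[of a] by simp
  qed
  moreover have "\<psi> a \<in> \<phi> ` B" for a
    using b by (simp add: \<psi>_def)
  ultimately show ?thesis
    using that[of \<psi> "Suc r"] \<psi>B fixed long by simp
qed

text \<open>Here \<open>\<tau>\<close> is the power \<open>q * p\<close> of the total extension:
  \<open>q\<close> makes reproduction uniform, and \<open>p\<close> comes from the tower.\<close>

lemma exists_self_similar_generator:
  fixes \<phi> :: "'a \<Rightarrow> 'a list"
  assumes B: "alphabet B" and x: "x \<in> UNIV \<rightarrow> B" and \<phi>: "substitution B \<phi>" "subst_seq \<phi> x = x"
    and z: "limit_of z x"
  obtains y \<tau> P M where "limit_of z y" "limit_of y z" "tail P y = subst_seq \<tau> (tail M y)"
    "\<And>a. 3 \<le> length (\<tau> a)" "\<And>a. set (\<tau> a) \<subseteq> B"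
    "\<And>k. constant_length k B \<phi> \<Longrightarrow> \<exists>p\<ge>1. \<forall>a. length (\<tau> a) = k ^ p"
proof -
  have fin: "finite B"
    using B by (simp add: alphabet_def)
  obtain \<psi> r where \<psi>: "\<And>a. set (\<psi> a) \<subseteq> B" "\<And>a. \<psi> a \<in> \<phi> ` B" "subst_seq \<psi> x = x" "nonerasing \<psi>"
    and r: "1 \<le> r" "\<And>a. 3 \<le> length (subst_pow \<psi> r a)"
    using total_extension[OF B x \<phi>] by metis
  obtain q where q: "1 \<le> q" "\<And>a. 3 \<le> length (subst_pow \<psi> q a)"
    and rep: "\<And>a b m. a \<in> B \<Longrightarrow> b \<in> B \<Longrightarrow> 1 \<le> m \<Longrightarrow> reproduces (subst_pow \<psi> m) a b
      \<Longrightarrow> reproduces (subst_pow \<psi> q) a b"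
    using exists_uniform_power[OF fin r] by metis
  have rep_q: "reproduces (subst_pow \<psi> q) a b"
    if "a \<in> B" "b \<in> B" "1 \<le> m" "reproduces (subst_pow (subst_pow \<psi> q) m) a b" for a b m
    using rep[of a b "q * m"] that q(1) by (simp add: subst_pow_mult)
  have "\<exists>y p P M. limit_of z y \<and> limit_of y z \<and> 1 \<le> p \<and>
      tail P y = subst_seq (subst_pow (subst_pow \<psi> q) p) (tail M y)"
    by (rule exists_eventually_self_similar[OF fin x q(2) subst_seq_pow_fixed[OF \<psi>(4,3)] z])
      (rule rep_q)
  then obtain y p P M where y: "limit_of z y" "limit_of y z" "1 \<le> p"
      "tail P y = subst_seq (subst_pow (subst_pow \<psi> q) p) (tail M y)"
    by blast
  let ?\<tau> = "subst_pow \<psi> (q * p)"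
  have qp: "1 \<le> q * p"
    using q(1) y(3) by simp
  show ?thesis
  proof (rule that[of y P ?\<tau> M])
    show "limit_of z y" "limit_of y z" "tail P y = subst_seq ?\<tau> (tail M y)"
      using y by (simp_all add: subst_pow_mult)
    show "3 \<le> length (?\<tau> a)" for a
    proof -
      have "3 ^ 1 \<le> (3 :: nat) ^ p"
        using y(3) by (intro power_increasing) auto
      also have "\<dots> \<le> length (?\<tau> a)"
        unfolding subst_pow_mult by (rule length_subst_pow_ge) (rule q(2))
      finally show ?thesis by simp
    qed
    show "set (?\<tau> a) \<subseteq> B" for a
      using qp by (intro set_subst_pow \<psi>(1)) simp
    show "\<exists>p\<ge>1. \<forall>a. length (?\<tau> a) = k ^ p" if "constant_length k B \<phi>" for k
    proof -
      have "length (\<psi> a) = k" for a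
        using \<psi>(2)[of a] that by (auto simp: constant_length_def)
      then show ?thesis
        using qp length_subst_pow_const[of \<psi> k "q * p"] by blast
    qed
  qed
qed

text \<open>The orbit closure depends only on the finite factors of the generator, so
  \<open>z\<close> may be exchanged for any \<open>y\<close> with the same factors.\<close>

lemma transitive_subsystem_lift:
  assumes "x \<in> UNIV \<rightarrow> B" "finite B" "\<pi> \<in> B \<rightarrow> A" "transitive_system A Y" "Y \<subseteq> orbit_closure A (\<pi> \<circ> x)"
  obtains z where "limit_of z x"
    "\<And>y. limit_of z y \<Longrightarrow> limit_of y z \<Longrightarrow> Y = orbit_closure A (\<pi> \<circ> y)"
proof -
  have \<pi>x: "\<pi> \<circ> x \<in> UNIV \<rightarrow> A"
    using assms(1,3) by (auto simp: Pi_iff)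
  obtain w where w: "w \<in> Y" "Y = orbit_closure A w"
    using assms(4) by (auto simp: transitive_system_def)
  then have "limit_of w (\<pi> \<circ> x)"
    using assms(5) orbit_closure_iff[OF \<pi>x] by blast
  then obtain z where z: "limit_of z x" "w = \<pi> \<circ> z"
    using limit_of_coding_lift[OF assms(2,1)] by metis
  show ?thesis
  proof (rule that[OF z(1)])
    fix y
    assume "limit_of z y" "limit_of y z"
    moreover have "\<pi> \<circ> z \<in> UNIV \<rightarrow> A"
      using limit_of_in[OF z(1) assms(1)] assms(3) by (auto simp: Pi_iff)
    ultimately show "Y = orbit_closure A (\<pi> \<circ> y)"
      unfolding w(2) z(2) by (intro orbit_closure_eqI limit_of_coding)
  qed
qed

lemma substitutive_coding:
  assumes "substitutive B y" "\<pi> \<in> B \<rightarrow> A"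
  shows "substitutive A (\<pi> \<circ> y)"
proof -
  obtain C :: "nat set" and w \<rho> where C: "purely_substitutive C w" "\<rho> \<in> C \<rightarrow> B" "y = \<rho> \<circ> w"
    using assms(1) unfolding substitutive_def by blast
  have "\<pi> \<circ> \<rho> \<in> C \<rightarrow> A"
    using C(2) assms(2) by auto
  then show ?thesis
    using substitutiveI[OF C(1)] C(3) by (metis comp_assoc)
qed

lemma automatic_coding:
  assumes "automatic k B y" "\<pi> \<in> B \<rightarrow> A"
  shows "automatic k A (\<pi> \<circ> y)"
proof -
  obtain C :: "nat set" and w \<rho> where C: "purely_automatic k C w" "\<rho> \<in> C \<rightarrow> B" "y = \<rho> \<circ> w"
    using assms(1) unfolding automatic_def by blast
  have "\<pi> \<circ> \<rho> \<in> C \<rightarrow> A"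
    using C(2) assms(2) by auto
  then show ?thesis
    using automaticI[OF C(1)] C(3) by (metis comp_assoc)
qed

lemma transitive_subsystem_substitutive:
  assumes "substitutive_system A X" "transitive_system A Y" "Y \<subseteq> X"
  shows "substitutive_system A Y"
proof -
  obtain B :: "nat set" and x \<pi> where x: "purely_substitutive B x" "\<pi> \<in> B \<rightarrow> A"
      and X: "X = orbit_closure A (\<pi> \<circ> x)"
    using assms(1) unfolding substitutive_system_def substitutive_def by blast
  obtain \<phi> where B: "alphabet B" and xB: "x \<in> UNIV \<rightarrow> B" and \<phi>: "substitution B \<phi>" "subst_seq \<phi> x = x"
    using x(1) unfolding purely_substitutive_def by blast
  have fin: "finite B"
    using B by (simp add: alphabet_def)
  obtain z where z: "limit_of z x"
      "\<And>y. limit_of z y \<Longrightarrow> limit_of y z \<Longrightarrow> Y = orbit_closure A (\<pi> \<circ> y)"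
    using transitive_subsystem_lift[OF xB fin x(2) assms(2)] assms(3) X by blast
  obtain y \<tau> P M where y: "limit_of z y" "limit_of y z" "tail P y = subst_seq \<tau> (tail M y)"
      and \<tau>: "\<And>a. 3 \<le> length (\<tau> a)" "\<And>a. set (\<tau> a) \<subseteq> B"
    using exists_self_similar_generator[OF B xB \<phi> z(1)] by metis
  have "y \<in> UNIV \<rightarrow> B"
    using limit_of_in y(2) z(1) xB by blast
  then have "substitutive B y"
    using substitutive_of_eventually_self_similar[OF fin _ \<tau> y(3)] by blast
  then show ?thesis
    unfolding substitutive_system_def using z(2)[OF y(1,2)] substitutive_coding x(2) by blast
qed

lemma transitive_subsystem_automatic:
  assumes "automatic_system k A X" "transitive_system A Y" "Y \<subseteq> X"
  shows "automatic_system k A Y"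
proof -
  obtain B :: "nat set" and x \<pi> where x: "purely_automatic k B x" "\<pi> \<in> B \<rightarrow> A"
      and X: "X = orbit_closure A (\<pi> \<circ> x)"
    using assms(1) unfolding automatic_system_def automatic_def by blast
  obtain \<phi> where k: "2 \<le> k" and B: "alphabet B" and xB: "x \<in> UNIV \<rightarrow> B"
      and \<phi>: "substitution B \<phi>" "subst_seq \<phi> x = x" and const: "constant_length k B \<phi>"
    using x(1) unfolding purely_automatic_def by blast
  have fin: "finite B"
    using B by (simp add: alphabet_def)
  obtain z where z: "limit_of z x"
      "\<And>y. limit_of z y \<Longrightarrow> limit_of y z \<Longrightarrow> Y = orbit_closure A (\<pi> \<circ> y)"
    using transitive_subsystem_lift[OF xB fin x(2) assms(2)] assms(3) X by blast
  obtain y \<tau> P M where y: "limit_of z y" "limit_of y z" "tail P y = subst_seq \<tau> (tail M y)"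
      and len: "\<exists>p\<ge>1. \<forall>a. length (\<tau> a) = k ^ p"
    using exists_self_similar_generator[OF B xB \<phi> z(1)] const by metis
  obtain p where p: "1 \<le> p" "\<And>a. length (\<tau> a) = k ^ p"
    using len by blast
  have "y \<in> UNIV \<rightarrow> B"
    using limit_of_in y(2) z(1) xB by blast
  then have "automatic k B y"
    using automatic_of_eventually_self_similar[OF k p(1) fin _ p(2) y(3)] by blast
  then show ?thesis
    unfolding automatic_system_def using z(2)[OF y(1,2)] automatic_coding x(2) by blast
qed

theorem theorem2p1:
  fixes A :: "'a set"
  assumes "alphabet A"
  shows "(\<forall>X Y. substitutive_system A X \<and> transitive_system A Y \<and> Y \<subseteq> X
            \<longrightarrow> substitutive_system A Y)
       \<and> (\<forall>k\<ge>2. \<forall>X Y. automatic_system k A X \<and> transitive_system A Y \<and> Y \<subseteq> X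
            \<longrightarrow> automatic_system k A Y)"
  using transitive_subsystem_substitutive transitive_subsystem_automatic by blast

end
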